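(* There exists an isolated group that is 3-solvable and non-Hopfian.
   Context: $F_m$ is the free group of rank $m$, and $\mathcal{G}_m$ is the set of normal subgroups of $F_m$ with the topology induced by the product topology on $\{0,1\}^{F_m}$; a point $N$ represents the marked group $F_m/N$. A group $G$ is isolated if it is finitely generated and, for some $m$ and some normal subgroup $N$ of $F_m$ with $F_m/N\cong G$, the point $N$ is isolated in $\mathcal{G}_m$ (this does not depend on the choice of $m$ and $N$). A group is $k$-solvable if the $k$-th term of its derived series is trivial (so 2-solvable means metabelian). A group $G$ is non-Hopfian if there exists a surjective homomorphism $G\to G$ with non-trivial kernel. *)

theory Defs
  imports "HOL-Algebra.Algebra" "HOL-Analysis.Analysis"
begin

text \<open>
  A letter \<open>(False, i)\<close> stands for the generator \<open>x\<^sub>i\<close> and \<open>(True, i)\<close> for its inverse.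
\<close>

type_synonym letter = "bool \<times> nat"

definition inv_letter :: "letter \<Rightarrow> letter" where
  "inv_letter a = (\<not> fst a, snd a)"

fun reduced_word :: "letter list \<Rightarrow> bool" where
  "reduced_word (a # b # w) \<longleftrightarrow> b \<noteq> inv_letter a \<and> reduced_word (b # w)"
| "reduced_word _ \<longleftrightarrow> True"

fun cons_red :: "letter \<Rightarrow> letter list \<Rightarrow> letter list" where
  "cons_red a [] = [a]"
| "cons_red a (b # w) = (if b = inv_letter a then w else a # b # w)"

text \<open>
  The free group of rank \<open>m\<close>: reduced words in \<open>x\<^sub>0, \<dots>, x\<^sub>m\<^sub>-\<^sub>1\<close>. For reduced \<open>u\<close> and \<open>v\<close>,
  the product below is the reduced form of the concatenation \<open>u @ v\<close>.
\<close>

definition free_group :: "nat \<Rightarrow> letter list monoid" where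
  "free_group m =
    \<lparr> carrier = {w. reduced_word w \<and> set w \<subseteq> UNIV \<times> {..<m}},
      monoid.mult = (\<lambda>u v. foldr cons_red u v),
      one = [] \<rparr>"

lemma inv_letter_inv_letter [simp]: "inv_letter (inv_letter a) = a"
  by (simp add: inv_letter_def)

lemma inv_letter_neq [simp]: "inv_letter a \<noteq> a" "a \<noteq> inv_letter a"
  by (auto simp: inv_letter_def prod_eq_iff)

lemma snd_inv_letter [simp]: "snd (inv_letter a) = snd a"
  by (simp add: inv_letter_def)

lemma inv_letter_mem_iff [simp]: "inv_letter a \<in> UNIV \<times> A \<longleftrightarrow> a \<in> UNIV \<times> A"
  by (cases a) (simp add: inv_letter_def)

lemma reduced_ConsD: "reduced_word (a # w) \<Longrightarrow> reduced_word w"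
  by (cases w) auto

lemma reduced_cons_red: "reduced_word w \<Longrightarrow> reduced_word (cons_red a w)"
  by (cases w) (auto dest: reduced_ConsD)

lemma reduced_foldr: "reduced_word v \<Longrightarrow> reduced_word (foldr cons_red u v)"
  by (induction u) (auto intro: reduced_cons_red)

lemma set_cons_red: "set (cons_red a w) \<subseteq> insert a (set w)"
  by (cases w) auto

lemma set_foldr_cons_red: "set (foldr cons_red u v) \<subseteq> set u \<union> set v"
proof (induction u)
  case (Cons a u)
  then show ?case
    using set_cons_red[of a "foldr cons_red u v"] by auto
qed simp

lemma cons_red_reduced: "reduced_word (a # w) \<Longrightarrow> cons_red a w = a # w"
  by (cases w) auto

lemma cons_red_cancel: "reduced_word w \<Longrightarrow> cons_red a (cons_red (inv_letter a) w) = w"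
proof (cases w)
  case (Cons b v)
  assume "reduced_word w"
  with Cons show ?thesis by (cases v) auto
qed simp

lemma foldr_reduced: "reduced_word w \<Longrightarrow> foldr cons_red w [] = w"
proof (induction w)
  case (Cons a w)
  then have "foldr cons_red w [] = w" by (blast dest: reduced_ConsD)
  then show ?case using cons_red_reduced[OF Cons.prems] by simp
qed simp

lemma foldr_cons_red:
  assumes "reduced_word v"
  shows "foldr cons_red (cons_red a u) v = cons_red a (foldr cons_red u v)"
proof (cases u)
  case (Cons b w)
  then show ?thesis
    using cons_red_cancel[OF reduced_foldr[OF assms, of w], of a] by auto
qed simp

lemma foldr_assoc:
  assumes "reduced_word w"
  shows "foldr cons_red (foldr cons_red u v) w = foldr cons_red u (foldr cons_red v w)"
  by (induction u) (auto simp: foldr_cons_red[OF assms])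

lemma foldr_inverse:
  "reduced_word v \<Longrightarrow> foldr cons_red (rev (map inv_letter w)) (foldr cons_red w v) = v"
proof (induction w)
  case (Cons a w)
  then show ?case
    using cons_red_cancel[OF reduced_foldr[of v w], of "inv_letter a"] by simp
qed simp

lemma group_free_group: "group (free_group m)"
proof (rule groupI)
  fix x y assume "x \<in> carrier (free_group m)" "y \<in> carrier (free_group m)"
  then show "x \<otimes>\<^bsub>free_group m\<^esub> y \<in> carrier (free_group m)"
    using set_foldr_cons_red[of x y] by (auto simp: free_group_def reduced_foldr)
next
  show "\<one>\<^bsub>free_group m\<^esub> \<in> carrier (free_group m)"
    by (simp add: free_group_def)
next
  fix x y z
  assume "x \<in> carrier (free_group m)" "y \<in> carrier (free_group m)" "z \<in> carrier (free_group m)"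
  then show "x \<otimes>\<^bsub>free_group m\<^esub> y \<otimes>\<^bsub>free_group m\<^esub> z =
      x \<otimes>\<^bsub>free_group m\<^esub> (y \<otimes>\<^bsub>free_group m\<^esub> z)"
    by (simp add: free_group_def foldr_assoc)
next
  fix x assume "x \<in> carrier (free_group m)"
  then show "\<one>\<^bsub>free_group m\<^esub> \<otimes>\<^bsub>free_group m\<^esub> x = x"
    by (simp add: free_group_def)
next
  fix x assume x: "x \<in> carrier (free_group m)"
  let ?y = "foldr cons_red (rev (map inv_letter x)) []"
  have "set (rev (map inv_letter x)) \<subseteq> UNIV \<times> {..<m}"
    using x by (auto simp: free_group_def inv_letter_def)
  then have "set ?y \<subseteq> UNIV \<times> {..<m}"
    using set_foldr_cons_red[of "rev (map inv_letter x)" "[]"] by auto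
  then have "?y \<in> carrier (free_group m)"
    by (simp add: free_group_def reduced_foldr)
  moreover have "foldr cons_red ?y x = []"
  proof -
    have "foldr cons_red ?y x = foldr cons_red (rev (map inv_letter x)) x"
      using x foldr_assoc[of x "rev (map inv_letter x)" "[]"] by (simp add: free_group_def)
    also have "\<dots> = foldr cons_red (rev (map inv_letter x)) (foldr cons_red x [])"
      using x by (simp add: free_group_def foldr_reduced)
    also have "\<dots> = []"
      by (simp add: foldr_inverse)
    finally show ?thesis .
  qed
  ultimately show "\<exists>y\<in>carrier (free_group m). y \<otimes>\<^bsub>free_group m\<^esub> x = \<one>\<^bsub>free_group m\<^esub>"
    by (intro bexI[of _ ?y]) (simp_all add: free_group_def)
qed

text \<open>The universal property of \<open>free_group m\<close> on the generators \<open>[(False, i)]\<close>.\<close>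

definition letter_val :: "('a, 'b) monoid_scheme \<Rightarrow> (nat \<Rightarrow> 'a) \<Rightarrow> letter \<Rightarrow> 'a" where
  "letter_val G g a = (if fst a then inv\<^bsub>G\<^esub> g (snd a) else g (snd a))"

definition word_val :: "('a, 'b) monoid_scheme \<Rightarrow> (nat \<Rightarrow> 'a) \<Rightarrow> letter list \<Rightarrow> 'a" where
  "word_val G g w = foldr (\<lambda>a x. letter_val G g a \<otimes>\<^bsub>G\<^esub> x) w \<one>\<^bsub>G\<^esub>"

lemma free_group_universal:
  assumes "group G" and g: "\<And>i. i < m \<Longrightarrow> g i \<in> carrier G"
  shows "word_val G g \<in> hom (free_group m) G"
    and "\<And>i. i < m \<Longrightarrow> word_val G g [(False, i)] = g i"
proof -
  interpret group G by fact
  have lv: "letter_val G g a \<in> carrier G" if "a \<in> UNIV \<times> {..<m}" for a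
    using that g by (auto simp: letter_val_def)
  have lvi: "letter_val G g a \<otimes>\<^bsub>G\<^esub> (letter_val G g (inv_letter a) \<otimes>\<^bsub>G\<^esub> x) = x"
    if "a \<in> UNIV \<times> {..<m}" "x \<in> carrier G" for a x
  proof -
    have "letter_val G g a \<otimes>\<^bsub>G\<^esub> letter_val G g (inv_letter a) = \<one>\<^bsub>G\<^esub>"
      using that g by (auto simp: letter_val_def inv_letter_def r_inv l_inv)
    then show ?thesis
      using that lv by (simp flip: m_assoc)
  qed
  have closed: "word_val G g w \<in> carrier G" if "set w \<subseteq> UNIV \<times> {..<m}" for w
    using that lv by (induction w) (auto simp: word_val_def)
  have cr: "word_val G g (cons_red a w) = letter_val G g a \<otimes>\<^bsub>G\<^esub> word_val G g w"
    if "set (a # w) \<subseteq> UNIV \<times> {..<m}" for a w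
  proof (cases w)
    case (Cons b v)
    have "word_val G g v \<in> carrier G" using that Cons closed by simp
    then show ?thesis
      using Cons that lvi[of a "word_val G g v"] by (auto simp: word_val_def)
  qed (simp add: word_val_def)
  have mult: "word_val G g (foldr cons_red u v) = word_val G g u \<otimes>\<^bsub>G\<^esub> word_val G g v"
    if "set u \<subseteq> UNIV \<times> {..<m}" "set v \<subseteq> UNIV \<times> {..<m}" for u v
    using that
  proof (induction u)
    case Nil
    then show ?case using closed[of v] by (simp add: word_val_def)
  next
    case (Cons a u)
    have "set (a # foldr cons_red u v) \<subseteq> UNIV \<times> {..<m}"
      using Cons.prems set_foldr_cons_red[of u v] by auto
    then have "word_val G g (foldr cons_red (a # u) v) =
        letter_val G g a \<otimes>\<^bsub>G\<^esub> (word_val G g u \<otimes>\<^bsub>G\<^esub> word_val G g v)"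
      using Cons cr by simp
    then show ?case
      using Cons.prems lv closed by (simp add: word_val_def m_assoc)
  qed
  show "word_val G g \<in> hom (free_group m) G"
    using closed mult by (auto simp: hom_def free_group_def)
  show "word_val G g [(False, i)] = g i" if "i < m" for i
    using that g by (simp add: word_val_def letter_val_def)
qed

lemma generate_free_group:
  "generate (free_group m) ((\<lambda>i. [(False, i)]) ` {..<m}) = carrier (free_group m)"
proof -
  let ?F = "free_group m" and ?S = "(\<lambda>i. [(False, i)]) ` {..<m}"
  interpret group ?F by (rule group_free_group)
  have S: "?S \<subseteq> carrier ?F" by (auto simp: free_group_def)
  have letter: "[a] \<in> generate ?F ?S" if "snd a < m" for a
  proof (cases "fst a")
    case True
    have "inv\<^bsub>?F\<^esub> [(False, snd a)] = [a]"
      by (rule inv_equality)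
         (use that True in \<open>auto simp: free_group_def inv_letter_def prod_eq_iff mem_Times_iff\<close>)
    then show ?thesis
      using that generate.inv[of "[(False, snd a)]" ?S ?F] by auto
  next
    case False
    then show ?thesis
      using that by (intro generate.incl) (auto simp: image_iff prod_eq_iff)
  qed
  have "w \<in> generate ?F ?S" if "reduced_word w" "set w \<subseteq> UNIV \<times> {..<m}" for w
    using that
  proof (induction w)
    case Nil
    then show ?case using generate.one[of ?F ?S] by (simp add: free_group_def)
  next
    case (Cons a w)
    have "w \<in> generate ?F ?S" using Cons by (auto dest: reduced_ConsD)
    then have "[a] \<otimes>\<^bsub>?F\<^esub> w \<in> generate ?F ?S"
      using Cons.prems by (intro generate.eng letter) auto
    then show ?case
      using Cons.prems by (simp add: free_group_def cons_red_reduced)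
  qed
  then have "carrier ?F \<subseteq> generate ?F ?S" by (auto simp: free_group_def)
  then show ?thesis using generate_incl[OF S] by blast
qed

text \<open>
  The topology on the set of normal subgroups of \<open>free_group m\<close> induced by the product topology
  on the space of functions from its carrier to the discrete two-point space, a subgroup being
  identified with its indicator function.
\<close>

definition marked_groups :: "nat \<Rightarrow> letter list set topology" where
  "marked_groups m =
    pullback_topology {N. N \<lhd> free_group m}
      (\<lambda>N. \<lambda>w\<in>carrier (free_group m). w \<in> N)
      (product_topology (\<lambda>_. discrete_topology (UNIV :: bool set)) (carrier (free_group m)))"

lemma topspace_marked_groups: "topspace (marked_groups m) = {N. N \<lhd> free_group m}"
  by (auto simp: marked_groups_def topspace_pullback_topology)

definition finitely_generated_group :: "('a, 'b) monoid_scheme \<Rightarrow> bool" where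
  "finitely_generated_group G \<longleftrightarrow>
    group G \<and> (\<exists>S. finite S \<and> S \<subseteq> carrier G \<and> generate G S = carrier G)"

definition isolated_group :: "('a, 'b) monoid_scheme \<Rightarrow> bool" where
  "isolated_group G \<longleftrightarrow>
    finitely_generated_group G \<and>
    (\<exists>m N. N \<lhd> free_group m \<and> free_group m Mod N \<cong> G \<and> openin (marked_groups m) {N})"

definition k_solvable :: "nat \<Rightarrow> ('a, 'b) monoid_scheme \<Rightarrow> bool" where
  "k_solvable k G \<longleftrightarrow> group G \<and> (derived G ^^ k) (carrier G) = {\<one>\<^bsub>G\<^esub>}"

definition non_hopfian :: "('a, 'b) monoid_scheme \<Rightarrow> bool" where
  "non_hopfian G \<longleftrightarrow> group G \<and> (\<exists>f \<in> epi G G. kernel G G f \<noteq> {\<one>\<^bsub>G\<^esub>})"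

end

theory Submission
  imports Defs
begin

text \<open>
  The group is the quotient \<open>A/Z\<close> of a group \<open>A\<close> introduced by Abels. Here \<open>A\<close> consists of the upper
  triangular \<open>4 \<times> 4\<close> matrices over \<open>\<int>[1/2]\<close> with diagonal \<open>(1, 2\<^sup>i, 2\<^sup>j, 1)\<close>; the matrices that differ
  from the identity in the upper right corner only form a central subgroup isomorphic to \<open>\<int>[1/2]\<close>,
  and \<open>Z\<close> is the copy of \<open>\<int>\<close> in it.

  Two properties come directly from the matrices. The group \<open>A\<close> is 3-solvable, because its derived
  group is unipotent and the second derived group of the unipotent matrices is trivial. Doubling the
  first row outside the diagonal (conjugation by \<open>diag(2, 1, 1, 1)\<close>) is an automorphism of \<open>A\<close> that maps
  \<open>Z\<close> onto \<open>2Z\<close>; on \<open>A/Z\<close> it induces a surjection that kills the class of the corner entry \<open>1/2\<close>.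

  For the isolation of \<open>A/Z\<close> two facts are combined: \<open>A/Z\<close> is finitely presented
  (\<open>abels_relators_present\<close>), and every non-trivial normal subgroup of \<open>A/Z\<close> contains the class of the
  corner entry \<open>1/2\<close> (\<open>half_mem_normal_subgroup\<close>). Write \<open>A/Z = F/N\<close> with \<open>F\<close> free, and let the word \<open>w\<close>
  represent that class. A normal subgroup \<open>M\<close> of \<open>F\<close> that contains the finitely many relators contains
  \<open>N\<close>, and if moreover \<open>w \<notin> M\<close>, then \<open>M/N\<close> is trivial. So finitely many conditions on membership of words
  determine \<open>N\<close>.

  The second fact holds because commutators with elementary matrices push a matrix into the corner,
  where the cosets of \<open>\<int>\<close> in \<open>\<int>[1/2]\<close> form a Pruefer group, whose non-trivial subgroups all contain the
  class of \<open>1/2\<close>. For the first one, five elementary matrices and the two diagonal generators are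
  subjected to finitely many relations. The diagonal generators stretch each generator into a
  one-parameter subgroup over \<open>\<int>[1/2]\<close> (\<open>dyadic_power\<close>). For all pairs of matrix positions except
  \<open>(13, 34)\<close> and \<open>(12, 24)\<close>, some diagonal element scales the one parameter and fixes the other, so
  one relation spreads to all parameters (\<open>bilinear_commutation\<close>). The two exceptional pairs, in which
  the diagonal matrices scale inversely to each other, are controlled by the identity
  \<open>[[a, b], c] = [a, [b, c]]\<close>, valid here for commuting \<open>a\<close> and \<open>c\<close> (\<open>triple_commutator\<close>). It implies that
  their commutators depend only on the product of the parameters and are central.
\<close>

section \<open>Dyadic rationals\<close>

typedef dyadic = "{x :: rat. \<exists>(n :: int) (k :: nat). x = of_int n / 2 ^ k}"
  by auto

setup_lifting type_definition_dyadic

instantiation dyadic :: idom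
begin

lift_definition zero_dyadic :: dyadic is 0
  by (rule exI[of _ 0]) simp

lift_definition one_dyadic :: dyadic is 1
  by (rule exI[of _ 1], rule exI[of _ 0]) simp

lift_definition plus_dyadic :: "dyadic \<Rightarrow> dyadic \<Rightarrow> dyadic" is "(+)"
proof (elim exE)
  fix x y :: rat and n m :: int and k l :: nat
  assume "x = of_int n / 2 ^ k" "y = of_int m / 2 ^ l"
  then have "x + y = of_int (n * 2 ^ l + m * 2 ^ k) / 2 ^ (k + l)"
    by (simp add: power_add add_divide_distrib)
  then show "\<exists>n k. x + y = of_int n / 2 ^ k" by blast
qed

lift_definition uminus_dyadic :: "dyadic \<Rightarrow> dyadic" is uminus
  by (metis minus_divide_left of_int_minus)

lift_definition times_dyadic :: "dyadic \<Rightarrow> dyadic \<Rightarrow> dyadic" is "(*)"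
proof (elim exE)
  fix x y :: rat and n m :: int and k l :: nat
  assume "x = of_int n / 2 ^ k" "y = of_int m / 2 ^ l"
  then have "x * y = of_int (n * m) / 2 ^ (k + l)"
    by (simp add: power_add)
  then show "\<exists>n k. x * y = of_int n / 2 ^ k" by blast
qed

definition minus_dyadic :: "dyadic \<Rightarrow> dyadic \<Rightarrow> dyadic" where
  "minus_dyadic a b = a + - b"

instance
proof
  fix a b c :: dyadic
  show "a + b + c = a + (b + c)" by transfer simp
  show "a + b = b + a" by transfer simp
  show "0 + a = a" by transfer simp
  show "- a + a = 0" by transfer simp
  show "a - b = a + - b" by (simp add: minus_dyadic_def)
  show "a * b * c = a * (b * c)" by transfer simp
  show "a * b = b * a" by transfer simp
  show "1 * a = a" by transfer simp
  show "(a + b) * c = a * c + b * c" by transfer (simp add: algebra_simps)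
  show "a * (b + c) = a * b + a * c" by transfer (simp add: algebra_simps)
  show "0 * a = 0" "a * 0 = 0" by (transfer, simp)+
  show "(0 :: dyadic) \<noteq> 1" by transfer simp
  show "a * b \<noteq> 0" if "a \<noteq> 0" "b \<noteq> 0" using that by transfer simp
qed

end

instance dyadic :: countable
proof
  show "\<exists>f :: dyadic \<Rightarrow> nat. inj f"
    by (rule exI[of _ "to_nat \<circ> Rep_dyadic"])
       (auto intro!: inj_compose simp: Rep_dyadic_inject inj_on_def)
qed

lemma Rep_dyadic_of_nat: "Rep_dyadic (of_nat n) = of_nat n"
  by (induction n) (simp_all add: zero_dyadic.rep_eq one_dyadic.rep_eq plus_dyadic.rep_eq)

lemma Rep_dyadic_of_int: "Rep_dyadic (of_int n) = of_int n"
  by (cases n rule: int_cases2) (simp_all add: Rep_dyadic_of_nat uminus_dyadic.rep_eq)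

instance dyadic :: ring_char_0
proof
  show "inj (of_nat :: nat \<Rightarrow> dyadic)"
    by (metis Rep_dyadic_of_nat injI of_nat_eq_iff)
qed

lift_definition pow2 :: "int \<Rightarrow> dyadic" is "\<lambda>i. 2 powi i"
proof -
  fix i :: int
  show "\<exists>n k. (2 :: rat) powi i = of_int n / 2 ^ k"
  proof (cases "i \<ge> 0")
    case True
    then have "(2 :: rat) powi i = of_int (2 ^ nat i) / 2 ^ 0" by (simp add: power_int_def)
    then show ?thesis by blast
  next
    case False
    then have "(2 :: rat) powi i = of_int 1 / 2 ^ nat (- i)"
      by (simp add: power_int_def field_simps)
    then show ?thesis by blast
  qed
qed

lemma pow2_0 [simp]: "pow2 0 = 1"
  by transfer simp

lemma pow2_add: "pow2 (i + j) = pow2 i * pow2 j"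
  by transfer (simp add: power_int_add)

lemma pow2_1: "pow2 1 = 2"
proof -
  have "pow2 1 = 1 + 1" by transfer simp
  then show ?thesis by simp
qed

lemma pow2_nat: "pow2 (int k) = 2 ^ k"
  by (induction k) (simp_all add: pow2_add pow2_1)

lemma pow2_minus_cancel [simp]:
  "pow2 (- i) * pow2 i = 1" "pow2 i * pow2 (- i) = 1"
  "pow2 (- i) * (pow2 i * a) = a" "pow2 i * (pow2 (- i) * a) = a"
  by (simp_all flip: pow2_add mult.assoc)

lemma pow2_neq_1: "i \<noteq> 0 \<Longrightarrow> pow2 i \<noteq> 1"
proof (transfer)
  fix i :: int
  assume "i \<noteq> 0"
  then have "i > 0 \<or> i < 0" by auto
  then have "(2 :: rat) powi i > 1 \<or> (2 :: rat) powi i < 1"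
    by (auto simp: one_less_power_int intro: power_int_strict_increasing[of i 0 "2 :: rat", simplified])
  then show "(2 :: rat) powi i \<noteq> 1" by auto
qed

lemma dyadic_fraction: "\<exists>(n :: int) (k :: nat). a = of_int n * pow2 (- int k)"
proof -
  obtain n k where "Rep_dyadic a = of_int n / 2 ^ k" using Rep_dyadic[of a] by auto
  then have "Rep_dyadic a = Rep_dyadic (of_int n * pow2 (- int k))"
    by (simp add: times_dyadic.rep_eq pow2.rep_eq Rep_dyadic_of_int power_int_minus divide_inverse)
  then show ?thesis by (auto simp: Rep_dyadic_inject)
qed

lemma pow2_eq_of_int:
  assumes "i \<ge> 0"
  shows "pow2 i = of_int (2 ^ nat i)"
  using assms pow2_nat[of "nat i"] by simp

text \<open>
  Every dyadic rational is an integer halved finitely often, so a subgroup that is closed under halving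
  and contains \<open>1\<close> is everything. This is how statements about one-parameter subgroups are
  reduced to their generators.
\<close>

lemma dyadic_induct [case_names one diff half]:
  assumes one: "P 1"
    and diff: "\<And>a b. P a \<Longrightarrow> P b \<Longrightarrow> P (a - b)"
    and half: "\<And>a. P a \<Longrightarrow> P (pow2 (- 1) * a)"
  shows "P a"
proof -
  have 0: "P 0" using diff[OF one one] by simp
  have neg: "P (- a)" if "P a" for a using diff[OF 0 that] by simp
  have add: "P (a + b)" if "P a" "P b" for a b using diff[OF that(1) neg[OF that(2)]] by simp
  have int: "P (of_int n)" for n
    by (induction n rule: int_induct[of _ 0]) (auto intro: 0 one add diff)
  have "P (of_int n * pow2 (- int k))" for n k
  proof (induction k)
    case (Suc k)
    have "- int (Suc k) = -1 + - int k" by simp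
    then have "of_int n * pow2 (- int (Suc k)) = pow2 (- 1) * (of_int n * pow2 (- int k))"
      by (simp only: pow2_add) (simp add: ac_simps)
    with half[OF Suc] show ?case by (simp only:)
  qed (simp add: int)
  then show ?thesis using dyadic_fraction[of a] by auto
qed

lemma dyadic_odd_part:
  assumes "a \<noteq> 0"
  obtains i m where "a = of_int m * pow2 i" "odd m"
proof -
  obtain n k where a: "a = of_int n * pow2 (- int k)" using dyadic_fraction by blast
  with assms have "n \<noteq> 0" by auto
  then obtain l m where n: "n = 2 ^ l * m" "odd m"
    using multiplicity_decompose'[of n 2] by (metis odd_one not_is_unit_0 even_mult_iff dvd_refl)
  have "a = of_int m * pow2 (int l + - int k)"
    using a n pow2_add[of "int l" "- int k"] by (simp add: pow2_nat)
  with n(2) show thesis by (rule that[rotated])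
qed

lemma half_not_int: "pow2 (- 1) \<noteq> of_int n"
proof
  assume "pow2 (- 1) = of_int n"
  then have "1 = pow2 1 * of_int n" by (metis pow2_minus_cancel(2))
  then have "(of_int 1 :: dyadic) = of_int (2 * n)" by (simp add: pow2_1)
  then have "1 = 2 * n" by (subst (asm) of_int_eq_iff)
  then show False by presburger
qed

section \<open>Abels' group\<close>

text \<open>
  \<open>Abels a b c d e f i j\<close> is the product of the unitriangular matrix \<open>u\<close> with \<open>a = u\<^sub>1\<^sub>2\<close>, \<open>b = u\<^sub>2\<^sub>3\<close>,
  \<open>c = u\<^sub>3\<^sub>4\<close>, \<open>d = u\<^sub>1\<^sub>3\<close>, \<open>e = u\<^sub>2\<^sub>4\<close>, \<open>f = u\<^sub>1\<^sub>4\<close> and the diagonal matrix \<open>diag(1, 2\<^sup>i, 2\<^sup>j, 1)\<close>. Splitting off the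
  diagonal makes its action on the entries of \<open>u\<close> visible: conjugation multiplies the entry in row \<open>k\<close>
  and column \<open>l\<close> by the quotient of the diagonal entries \<open>k\<close> and \<open>l\<close>.
\<close>

datatype abels = Abels (x12: dyadic) (x23: dyadic) (x34: dyadic) (x13: dyadic) (x24: dyadic)
  (x14: dyadic) (exp2: int) (exp3: int)

instance abels :: countable
  by countable_datatype

fun abels_mult :: "abels \<Rightarrow> abels \<Rightarrow> abels" where
  "abels_mult (Abels a b c d e f i j) (Abels a' b' c' d' e' f' i' j') =
    Abels (a + pow2 (- i) * a') (b + pow2 (i - j) * b') (c + pow2 j * c')
      (d + pow2 (- j) * d' + a * pow2 (i - j) * b')
      (e + pow2 i * e' + b * pow2 j * c')
      (f + f' + a * pow2 i * e' + d * pow2 j * c')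
      (i + i') (j + j')"

definition abels_group :: "abels monoid" where
  "abels_group = \<lparr> carrier = UNIV, monoid.mult = abels_mult, one = Abels 0 0 0 0 0 0 0 0 \<rparr>"

lemma abels_group_simps [simp]:
  "carrier abels_group = UNIV"
  "monoid.mult abels_group = abels_mult"
  "one abels_group = Abels 0 0 0 0 0 0 0 0"
  by (simp_all add: abels_group_def)

lemma pow2_diff: "pow2 (i - j) = pow2 i * pow2 (- j)"
  using pow2_add[of i "- j"] by simp

lemma pow2_plus_minus: "pow2 (- (i + j)) = pow2 (- i) * pow2 (- j)"
  using pow2_add[of "- i" "- j"] by simp

lemma pow2_minus_diff: "pow2 (- i - j) = pow2 (- i) * pow2 (- j)"
  using pow2_add[of "- i" "- j"] by simp

lemma pow2_cancel_mid:
  "pow2 i * (x * pow2 (- i)) = x"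
  "pow2 i * (x * (y * pow2 (- i))) = x * y"
  by (simp_all add: ac_simps)

lemmas pow2_simps = pow2_add pow2_diff pow2_minus_diff pow2_plus_minus pow2_cancel_mid

fun abels_inv :: "abels \<Rightarrow> abels" where
  "abels_inv (Abels a b c d e f i j) =
    Abels (- pow2 i * a) (- pow2 (j - i) * b) (- pow2 (- j) * c)
      (pow2 j * (a * b - d)) (pow2 (- i) * (b * c - e))
      (a * e + d * c - a * b * c - f) (- i) (- j)"

lemma abels_left_inverse: "abels_mult (abels_inv g) g = Abels 0 0 0 0 0 0 0 0"
  by (cases g) (simp add: pow2_simps algebra_simps)

lemma group_abels_group: "group abels_group"
proof (rule groupI)
  fix g h k
  show "g \<otimes>\<^bsub>abels_group\<^esub> h \<otimes>\<^bsub>abels_group\<^esub> k = g \<otimes>\<^bsub>abels_group\<^esub> (h \<otimes>\<^bsub>abels_group\<^esub> k)"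
    by (cases g; cases h; cases k) (simp add: pow2_simps algebra_simps)
next
  fix g
  show "\<one>\<^bsub>abels_group\<^esub> \<otimes>\<^bsub>abels_group\<^esub> g = g"
    by (cases g) simp
next
  fix g
  show "\<exists>h \<in> carrier abels_group. h \<otimes>\<^bsub>abels_group\<^esub> g = \<one>\<^bsub>abels_group\<^esub>"
    using abels_left_inverse[of g] by auto
qed simp_all

interpretation Ab: group abels_group
  by (rule group_abels_group)

lemma inv_abels_group [simp]: "inv\<^bsub>abels_group\<^esub> g = abels_inv g"
  by (rule Ab.inv_equality) (simp_all add: abels_left_inverse)

lemma weights_abels_mult [simp]:
  "exp2 (abels_mult g h) = exp2 g + exp2 h" "exp3 (abels_mult g h) = exp3 g + exp3 h"
  by (cases g; cases h; simp)+

text \<open>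
  The commutator enters only through the equation \<open>c (h g) = g h\<close>; in this form it can be read off entry
  by entry from products, without computing inverses.
\<close>

lemma (in group) derived_subsetI:
  assumes "S \<subseteq> carrier G" "subgroup T G"
    and "\<And>g h c. g \<in> S \<Longrightarrow> h \<in> S \<Longrightarrow> c \<in> carrier G \<Longrightarrow> c \<otimes> (h \<otimes> g) = g \<otimes> h \<Longrightarrow> c \<in> T"
  shows "derived G S \<subseteq> T"
  unfolding derived_def
proof (rule generate_subgroup_incl[OF _ assms(2)], clarify)
  fix g h
  assume gh: "g \<in> S" "h \<in> S"
  then have [simp]: "g \<in> carrier G" "h \<in> carrier G" using assms(1) by auto
  have "g \<otimes> h \<otimes> inv g \<otimes> inv h \<otimes> (h \<otimes> g) = g \<otimes> h \<otimes> (inv g \<otimes> (inv h \<otimes> h) \<otimes> g)"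
    by (simp only: m_assoc m_closed inv_closed \<open>g \<in> carrier G\<close> \<open>h \<in> carrier G\<close>)
  also have "\<dots> = g \<otimes> h" by simp
  finally show "g \<otimes> h \<otimes> inv g \<otimes> inv h \<in> T"
    using gh by (intro assms(3)[of g h]) auto
qed

text \<open>
  The derived series descends through the unipotent matrices \<open>U\<close> and those of them, \<open>V\<close>, that vanish on
  the first superdiagonal; \<open>V\<close> is abelian.
\<close>

lemma derived_length_abels_group: "(derived abels_group ^^ 3) UNIV = {Abels 0 0 0 0 0 0 0 0}"
proof
  let ?A = abels_group
  define U where "U = {g. exp2 g = 0 \<and> exp3 g = 0}"
  define V where "V = {g \<in> U. x12 g = 0 \<and> x23 g = 0 \<and> x34 g = 0}"
  have U: "subgroup U ?A"
  proof (rule Ab.subgroupI)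
    show "U \<noteq> {}" unfolding U_def by (auto intro: exI[of _ "Abels 0 0 0 0 0 0 0 0"])
    show "inv\<^bsub>?A\<^esub> g \<in> U" if "g \<in> U" for g using that by (cases g) (simp add: U_def)
  qed (auto simp: U_def)
  have V: "subgroup V ?A"
  proof (rule Ab.subgroupI)
    show "V \<noteq> {}" unfolding V_def U_def by (auto intro: exI[of _ "Abels 0 0 0 0 0 0 0 0"])
    show "inv\<^bsub>?A\<^esub> g \<in> V" if "g \<in> V" for g using that by (cases g) (simp add: U_def V_def)
    show "g \<otimes>\<^bsub>?A\<^esub> h \<in> V" if "g \<in> V" "h \<in> V" for g h
      using that by (cases g; cases h) (simp add: U_def V_def)
  qed auto
  have 1: "derived ?A UNIV \<subseteq> U"
  proof (rule Ab.derived_subsetI[OF _ U])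
    fix g h c assume "c \<otimes>\<^bsub>?A\<^esub> (h \<otimes>\<^bsub>?A\<^esub> g) = g \<otimes>\<^bsub>?A\<^esub> h"
    from arg_cong[OF this, of exp2] arg_cong[OF this, of exp3] show "c \<in> U" by (simp add: U_def)
  qed simp
  have 2: "derived ?A U \<subseteq> V"
  proof (rule Ab.derived_subsetI[OF _ V])
    fix g h c assume "g \<in> U" "h \<in> U" "c \<otimes>\<^bsub>?A\<^esub> (h \<otimes>\<^bsub>?A\<^esub> g) = g \<otimes>\<^bsub>?A\<^esub> h"
    then show "c \<in> V" by (cases g; cases h; cases c) (auto simp: U_def V_def algebra_simps)
  qed simp
  have 3: "derived ?A V \<subseteq> {\<one>\<^bsub>?A\<^esub>}"
  proof (rule Ab.derived_subsetI[OF _ Ab.triv_subgroup])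
    fix g h c assume "g \<in> V" "h \<in> V" "c \<otimes>\<^bsub>?A\<^esub> (h \<otimes>\<^bsub>?A\<^esub> g) = g \<otimes>\<^bsub>?A\<^esub> h"
    then show "c \<in> {\<one>\<^bsub>?A\<^esub>}" by (cases g; cases h; cases c) (auto simp: U_def V_def algebra_simps)
  qed simp
  have "derived ?A (derived ?A UNIV) \<subseteq> V" using Ab.mono_derived[OF 1] 2 by blast
  then have "derived ?A (derived ?A (derived ?A UNIV)) \<subseteq> {\<one>\<^bsub>?A\<^esub>}"
    using Ab.mono_derived 3 by blast
  then show "(derived ?A ^^ 3) UNIV \<subseteq> {Abels 0 0 0 0 0 0 0 0}"
    by (simp add: numeral_3_eq_3)
  have "subgroup ((derived ?A ^^ 3) UNIV) ?A"
    using Ab.exp_of_derived_is_subgroup[OF Ab.subgroup_self] by simp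
  then show "{Abels 0 0 0 0 0 0 0 0} \<subseteq> (derived ?A ^^ 3) UNIV"
    using subgroup.one_closed by fastforce
qed

definition central_ints :: "abels set" where
  "central_ints = range (\<lambda>n :: int. Abels 0 0 0 0 0 (of_int n) 0 0)"

lemma normal_central_ints: "central_ints \<lhd> abels_group"
proof (rule Ab.normal_invI)
  show "subgroup central_ints abels_group"
  proof (rule Ab.subgroupI)
    fix g h assume "g \<in> central_ints" "h \<in> central_ints"
    then obtain m n where "g = Abels 0 0 0 0 0 (of_int m) 0 0" "h = Abels 0 0 0 0 0 (of_int n) 0 0"
      by (auto simp: central_ints_def)
    then show "g \<otimes>\<^bsub>abels_group\<^esub> h \<in> central_ints" "inv\<^bsub>abels_group\<^esub> g \<in> central_ints"
      by (auto simp: central_ints_def intro: image_eqI[of _ _ "m + n"] image_eqI[of _ _ "- m"])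
  qed (auto simp: central_ints_def)
  fix g h assume h: "h \<in> central_ints"
  then have "abels_mult g h = abels_mult h g"
    by (cases g) (auto simp: central_ints_def)
  then show "g \<otimes>\<^bsub>abels_group\<^esub> h \<otimes>\<^bsub>abels_group\<^esub> inv\<^bsub>abels_group\<^esub> g \<in> central_ints"
    using h Ab.m_assoc[of h g "abels_inv g"] Ab.r_inv[of g] Ab.r_one[of h] by (simp del: Ab.r_inv Ab.r_one)
qed

lemma (in normal) commutator_mem:
  assumes "g \<in> H" "h \<in> carrier G" "c \<in> carrier G" "g \<otimes> h = c \<otimes> (h \<otimes> g)"
  shows "c \<in> H"
proof -
  have [simp]: "g \<in> carrier G" using assms(1) by simp
  have "c = g \<otimes> (h \<otimes> inv g \<otimes> inv h)"
    using assms by (simp flip: m_assoc) (simp add: m_assoc inv_solve_right)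
  moreover have "h \<otimes> inv g \<otimes> inv h \<in> H"
    using assms by (intro inv_op_closed2) auto
  ultimately show ?thesis using assms(1) by simp
qed

text \<open>
  The centre meets every normal subgroup that is larger than \<open>\<int>\<close> in more than \<open>\<int>\<close>: as long as a matrix
  is not central, its commutator with a suitable elementary matrix is a non-trivial element
  closer to the corner. Once a commutator lands in the corner, it depends linearly on the parameter
  of the elementary matrix, so this parameter can be chosen to produce an odd multiple of \<open>1/2\<close>.
\<close>

lemma half_mem_normal_subgroup:
  assumes K: "K \<lhd> abels_group" and ints: "central_ints \<subseteq> K" and neq: "K \<noteq> central_ints"
  shows "Abels 0 0 0 0 0 (pow2 (- 1)) 0 0 \<in> K"
proof -
  interpret K: normal K abels_group by fact
  let ?z = "\<lambda>f. Abels 0 0 0 0 0 f 0 0"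
  have z_int: "?z (of_int n) \<in> K" for n using ints by (auto simp: central_ints_def)
  have z_add: "?z (u + v) \<in> K" if "?z u \<in> K" "?z v \<in> K" for u v
    using K.m_closed[OF that] by simp
  have z_neg: "?z (- u) \<in> K" if "?z u \<in> K" for u
    using K.m_inv_closed[OF that] by simp
  have comm: "c \<in> K" if "g \<in> K" "abels_mult g h = abels_mult c (abels_mult h g)" for c g h
    using K.commutator_mem[of g h c] that by simp
  have half: "?z (pow2 (- 1)) \<in> K" if "?z (of_int m * pow2 (- 1)) \<in> K" "odd m" for m
  proof -
    obtain l where m: "m = 2 * l + 1" using \<open>odd m\<close> by (rule oddE)
    have "of_int m * pow2 (- 1) + of_int (- l) = of_int l * (pow2 1 * pow2 (- 1)) + pow2 (- 1) - of_int l"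
      by (simp only: m pow2_1) (simp add: algebra_simps)
    also have "\<dots> = pow2 (- 1)" by (simp only: pow2_minus_cancel) simp
    finally show ?thesis using z_add[OF that(1) z_int[of "- l"]] by (simp only:)
  qed
  have half_mult: "?z (pow2 (- 1)) \<in> K" if "u \<noteq> 0" "\<And>v. ?z (u * v) \<in> K" for u
  proof -
    obtain i m where u: "u = of_int m * pow2 i" "odd m" using dyadic_odd_part \<open>u \<noteq> 0\<close> by blast
    then have "u * pow2 (- i - 1) = of_int m * pow2 (- 1)"
      using pow2_add[of i "- i - 1"] by (simp add: mult.assoc)
    then show ?thesis using that(2)[of "pow2 (- i - 1)"] u(2) half by simp
  qed
  have d_case: "?z (pow2 (- 1)) \<in> K" if "Abels 0 0 0 d e f 0 0 \<in> K" "d \<noteq> 0" for d e f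
  proof (rule half_mult[OF \<open>d \<noteq> 0\<close>])
    show "?z (d * v) \<in> K" for v
      by (rule comm[OF that(1), of "Abels 0 0 v 0 0 0 0 0"]) simp
  qed
  have e_case: "?z (pow2 (- 1)) \<in> K" if "Abels 0 0 0 d e f 0 0 \<in> K" "e \<noteq> 0" for d e f
  proof (rule half_mult[OF \<open>e \<noteq> 0\<close>])
    show "?z (e * v) \<in> K" for v
      by (rule comm[OF that(1), of "Abels (- v) 0 0 0 0 0 0 0"]) (simp add: ac_simps)
  qed
  obtain g where "g \<in> K" "g \<notin> central_ints" using ints neq by blast
  moreover obtain a b c d e f i j where g: "g = Abels a b c d e f i j" by (cases g)
  ultimately have gK: "Abels a b c d e f i j \<in> K" and f: "Abels a b c d e f i j \<notin> central_ints"
    by simp_all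
  \<comment> \<open>The diagonal part of the matrix is treated first, then the first superdiagonal, then the second one,
    and the case of a central matrix comes last.\<close>
  consider "j \<noteq> 0" | "i \<noteq> 0" | "i = 0" "j = 0" "a \<noteq> 0" | "i = 0" "j = 0" "c \<noteq> 0"
    | "i = 0" "j = 0" "a = 0" "c = 0" "b \<noteq> 0" | "i = 0" "j = 0" "a = 0" "b = 0" "c = 0" "d \<noteq> 0"
    | "i = 0" "j = 0" "a = 0" "b = 0" "c = 0" "e \<noteq> 0"
    | "i = 0" "j = 0" "a = 0" "b = 0" "c = 0" "d = 0" "e = 0"
    by argo
  then show ?thesis
  proof cases
    case 1
    have "Abels 0 0 0 (pow2 (- j) - 1) 0 (- (pow2 (- j) * c)) 0 0 \<in> K"
      by (rule comm[OF gK, of "Abels 0 0 0 1 0 0 0 0"]) (simp add: algebra_simps)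
    then show ?thesis by (rule d_case) (use pow2_neq_1[of "- j"] 1 in simp)
  next
    case 2
    have "Abels 0 0 0 0 (pow2 i - 1) (a * pow2 i) 0 0 \<in> K"
      by (rule comm[OF gK, of "Abels 0 0 0 0 1 0 0 0"]) (simp add: algebra_simps)
    then show ?thesis by (rule e_case) (use pow2_neq_1[of i] 2 in simp)
  next
    case 3
    show ?thesis
    proof (rule half_mult[OF \<open>a \<noteq> 0\<close>])
      show "?z (a * v) \<in> K" for v
        by (rule comm[OF gK, of "Abels 0 0 0 0 v 0 0 0"]) (use 3 in simp)
    qed
  next
    case 4
    show ?thesis
    proof (rule half_mult[OF \<open>c \<noteq> 0\<close>])
      show "?z (c * v) \<in> K" for v
        by (rule comm[OF gK, of "Abels 0 0 0 (- v) 0 0 0 0"]) (use 4 in \<open>simp add: ac_simps\<close>)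
    qed
  next
    case 5
    have "Abels 0 0 0 0 b d 0 0 \<in> K"
      by (rule comm[OF gK, of "Abels 0 0 1 0 0 0 0 0"]) (use 5 in simp)
    then show ?thesis using e_case 5 by blast
  next
    case 6
    with gK d_case show ?thesis by blast
  next
    case 7
    with gK e_case show ?thesis by blast
  next
    case 8
    have fK: "?z f \<in> K" and f_int: "f \<noteq> of_int n" for n
      using gK f 8 by (auto simp: central_ints_def)
    \<comment> \<open>Here \<open>f\<close> is an odd integer divided by \<open>2\<^sup>n\<close> with \<open>n > 0\<close>, and its multiple by \<open>2\<^sup>n\<^sup>-\<^sup>1\<close> is an odd
      multiple of \<open>1/2\<close>.\<close>
    from f_int[of 0] have "f \<noteq> 0" by simp
    then obtain k m where m: "f = of_int m * pow2 k" "odd m" using dyadic_odd_part by blast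
    have "k < 0"
    proof (rule ccontr)
      assume "\<not> k < 0"
      then have "f = of_int (m * 2 ^ nat k)" using m(1) by (simp add: pow2_eq_of_int)
      with f_int show False by blast
    qed
    have "?z (of_nat n * f) \<in> K" for n :: nat
    proof (induction n)
      case 0
      then show ?case using z_int[of 0] by simp
    next
      case (Suc n)
      then show ?case using z_add[OF fK Suc] by (simp add: algebra_simps)
    qed
    from this[of "2 ^ nat (- k - 1)"] have "?z (pow2 (- k - 1) * f) \<in> K"
      using \<open>k < 0\<close> by (simp add: pow2_eq_of_int)
    moreover have "pow2 (- k - 1) * f = of_int m * pow2 (- 1)"
      using pow2_add[of "- k - 1" k] by (simp add: m(1) ac_simps)
    ultimately show ?thesis using half m(2) by simp
  qed
qed

text \<open>
  Conjugation by \<open>diag(2, 1, 1, 1)\<close>, which is not an element of the group.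
\<close>

fun doubling :: "abels \<Rightarrow> abels" where
  "doubling (Abels a b c d e f i j) = Abels (2 * a) b c (2 * d) e (2 * f) i j"

lemma doubling_hom: "doubling \<in> hom abels_group abels_group"
proof (rule homI)
  fix g h
  show "doubling (g \<otimes>\<^bsub>abels_group\<^esub> h) = doubling g \<otimes>\<^bsub>abels_group\<^esub> doubling h"
    by (cases g; cases h) (simp add: algebra_simps)
qed simp

lemma surj_doubling: "surj doubling"
proof (rule surjI)
  fix g
  have "2 * (pow2 (- 1) * a) = a" for a
    using pow2_minus_cancel(4)[of 1 a] by (simp only: pow2_1)
  then show "doubling (case g of Abels a b c d e f i j \<Rightarrow>
      Abels (pow2 (- 1) * a) b c (pow2 (- 1) * d) e (pow2 (- 1) * f) i j) = g"
    by (cases g) simp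
qed

section \<open>Quotients of countable groups\<close>

text \<open>
  An epimorphism that maps the kernel of \<open>h\<close> into itself induces an epimorphism of the quotient, and the
  induced map is not injective if an element outside the kernel is mapped into it.
\<close>

lemma (in group_hom) non_hopfian_image:
  assumes surj: "h ` carrier G = carrier H"
    and \<beta>: "\<beta> \<in> epi G G" and stable: "\<And>x. x \<in> kernel G H h \<Longrightarrow> \<beta> x \<in> kernel G H h"
    and g: "g \<in> carrier G" "g \<notin> kernel G H h" "\<beta> g \<in> kernel G H h"
  shows "non_hopfian H"
proof -
  interpret \<beta>: group_hom G G \<beta>
    using \<beta> by unfold_locales (auto simp: epi_def)
  have "h (\<beta> x) = h (\<beta> y)" if xy: "x \<in> carrier G" "y \<in> carrier G" "h x = h y" for x y
  proof -
    have "x \<otimes> inv y \<in> kernel G H h" using xy by (simp add: kernel_def)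
    then have "h (\<beta> (x \<otimes> inv y)) = \<one>\<^bsub>H\<^esub>" using stable by (simp add: kernel_def)
    then have "h (\<beta> x) \<otimes>\<^bsub>H\<^esub> inv\<^bsub>H\<^esub> h (\<beta> y) = \<one>\<^bsub>H\<^esub>" using xy by simp
    then show ?thesis using xy by (metis H.inv_equality H.inv_inv H.inv_closed \<beta>.hom_closed hom_closed)
  qed
  then obtain f where f: "\<And>x. x \<in> carrier G \<Longrightarrow> h (\<beta> x) = f (h x)"
    using function_factors_left_gen[of "\<lambda>x. x \<in> carrier G" h "h \<circ> \<beta>"] by (metis comp_apply)
  have "f \<in> hom H H"
  proof (rule homI)
    fix u v assume "u \<in> carrier H" "v \<in> carrier H"
    then obtain x y where xy: "x \<in> carrier G" "u = h x" "y \<in> carrier G" "v = h y" using surj by blast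
    then show "f u \<in> carrier H" by (simp flip: f)
    have "f (h (x \<otimes> y)) = f (h x) \<otimes>\<^bsub>H\<^esub> f (h y)" using xy f[of "x \<otimes> y"] f[of x] f[of y] by simp
    then show "f (u \<otimes>\<^bsub>H\<^esub> v) = f u \<otimes>\<^bsub>H\<^esub> f v" using xy by simp
  qed
  moreover have "carrier H \<subseteq> f ` carrier H"
  proof
    fix u assume "u \<in> carrier H"
    then obtain x where x: "x \<in> carrier G" "u = h x" using surj by blast
    then obtain y where "y \<in> carrier G" "x = \<beta> y" using \<beta> by (auto simp: epi_def)
    then have "u = f (h y)" "h y \<in> carrier H" using x f by auto
    then show "u \<in> f ` carrier H" by blast
  qed
  ultimately have "f \<in> epi H H" by (simp add: epi_iff_subset)
  moreover have "h g \<in> kernel H H f" "h g \<noteq> \<one>\<^bsub>H\<^esub>"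
    using g f[OF g(1)] by (auto simp: kernel_def)
  ultimately show ?thesis unfolding non_hopfian_def by (metis H.is_group singletonD)
qed

text \<open>
  Enumerating one representative of each coset realises the quotient on a set of natural numbers.
\<close>

lemma countable_quotient_encoding:
  fixes G :: "('a :: countable, 'b) monoid_scheme" (structure)
  assumes N: "N \<lhd> G"
  shows "\<exists>q :: 'a \<Rightarrow> nat. weak_group_morphism q N G"
proof -
  interpret N: normal N G by fact
  define r where "r z = (SOME y. y \<in> N #> z)" for z
  have r: "N #> r z = N #> z" if "z \<in> carrier G" for z
    using someI[of "\<lambda>y. y \<in> N #> z" z] N.rcos_self[OF that N.subgroup_axioms]
      N.repr_independence[OF _ that N.subgroup_axioms, of "r z"] unfolding r_def by simp
  have "to_nat (r x) = to_nat (r y) \<longleftrightarrow> x \<otimes> inv y \<in> N" if "x \<in> carrier G" "y \<in> carrier G" for x y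
  proof -
    have "to_nat (r x) = to_nat (r y) \<longleftrightarrow> N #> x = N #> y"
      using r that by (metis r_def to_nat_split(1) inj_to_nat injD)
    also have "\<dots> \<longleftrightarrow> x \<in> N #> y"
      using that by (metis N.rcos_self N.repr_independence N.subgroup_axioms)
    also have "\<dots> \<longleftrightarrow> x \<otimes> inv y \<in> N"
      using N.rcos_module[OF N.is_group that(2,1)] .
    finally show ?thesis .
  qed
  then have "weak_group_morphism (\<lambda>x. to_nat (r x)) N G"
    by unfold_locales
  then show ?thesis by blast
qed

section \<open>One-parameter subgroups\<close>

context group
begin

text \<open>
  For a homomorphism \<open>P\<close> from the dyadic rationals into the group, this says that conjugation by \<open>u\<close>
  multiplies the parameter by \<open>2\<^sup>i\<close>; \<open>i = 0\<close> means that \<open>u\<close> centralises the image of \<open>P\<close>.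
\<close>

definition scales :: "'a \<Rightarrow> (dyadic \<Rightarrow> 'a) \<Rightarrow> int \<Rightarrow> bool" where
  "scales u P i \<longleftrightarrow> (\<forall>a. u \<otimes> P a = P (pow2 i * a) \<otimes> u)"

lemma scales_mult:
  assumes "scales u P i" "scales v P j" "u \<in> carrier G" "v \<in> carrier G" "\<And>a. P a \<in> carrier G"
  shows "scales (u \<otimes> v) P (i + j)"
  unfolding scales_def
proof
  fix a
  have "u \<otimes> v \<otimes> P a = u \<otimes> P (pow2 j * a) \<otimes> v"
    using assms(2-5) by (simp add: scales_def m_assoc)
  also have "u \<otimes> P (pow2 j * a) = P (pow2 (i + j) * a) \<otimes> u"
    using assms(1) by (simp add: scales_def pow2_add mult.assoc)
  also have "\<dots> \<otimes> v = P (pow2 (i + j) * a) \<otimes> (u \<otimes> v)"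
    using assms(3-5) by (simp add: m_assoc)
  finally show "u \<otimes> v \<otimes> P a = P (pow2 (i + j) * a) \<otimes> (u \<otimes> v)" .
qed

lemma scales_inv:
  assumes "scales u P i" "u \<in> carrier G" "\<And>a. P a \<in> carrier G"
  shows "scales (inv u) P (- i)"
  unfolding scales_def
proof
  fix a
  have "u \<otimes> P (pow2 (- i) * a) = P a \<otimes> u"
    using assms(1) by (simp add: scales_def)
  then have "u \<otimes> P (pow2 (- i) * a) \<otimes> inv u = P a"
    using assms by (simp add: inv_solve_right')
  then show "inv u \<otimes> P a = P (pow2 (- i) * a) \<otimes> inv u"
    using assms by (simp add: inv_solve_left' m_assoc)
qed

lemma scales_int_pow:
  assumes "scales u P i" "u \<in> carrier G" "\<And>a. P a \<in> carrier G"
  shows "scales (u [^] (n :: int)) P (n * i)"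
proof -
  have nat: "scales (u [^] (int m)) P (int m * i)" for m
  proof (induction m)
    case 0
    then show ?case using assms by (simp add: scales_def)
  next
    case (Suc m)
    have "scales (u \<otimes> u [^] (int m)) P (i + int m * i)"
      using Suc assms by (intro scales_mult) auto
    then show ?case
      using assms int_pow_mult[of u 1 "int m"] by (simp add: algebra_simps)
  qed
  show ?thesis
  proof (cases n rule: int_cases2)
    case (nonneg m)
    with nat show ?thesis by simp
  next
    case (nonpos m)
    with scales_inv[OF nat[of m]] assms show ?thesis by (simp add: int_pow_neg)
  qed
qed

lemma scalesD: "scales u P i \<Longrightarrow> u \<otimes> P a = P (pow2 i * a) \<otimes> u"
  by (simp add: scales_def)

lemma left_rule: "a \<otimes> b = c \<Longrightarrow> a \<in> carrier G \<Longrightarrow> b \<in> carrier G \<Longrightarrow> r \<in> carrier G \<Longrightarrow>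
    a \<otimes> (b \<otimes> r) = c \<otimes> r"
  by (simp flip: m_assoc)

text \<open>
  Suppose that \<open>[A 1, B 1] = C 1\<close> with \<open>C\<close> centralising \<open>A\<close> and \<open>B\<close>. Commutators are then biadditive, so
  \<open>[A m, B n] = C (m n)\<close> for integers. Conjugation by \<open>u\<close> halves the parameter of \<open>A\<close> and that of \<open>C\<close> while
  it fixes \<open>B\<close>; this extends the formula to all parameters of \<open>A\<close>, and \<open>v\<close> plays the same part for \<open>B\<close>.
\<close>

lemma bilinear_commutation:
  fixes A B C :: "dyadic \<Rightarrow> 'a"
  assumes closed [simp]: "\<And>a. A a \<in> carrier G" "\<And>a. B a \<in> carrier G" "\<And>a. C a \<in> carrier G"
    and A: "\<And>a b. A (a + b) = A a \<otimes> A b" and B: "\<And>a b. B (a + b) = B a \<otimes> B b"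
    and C: "\<And>a b. C (a + b) = C a \<otimes> C b"
    and AC: "\<And>a b. A a \<otimes> C b = C b \<otimes> A a" and BC: "\<And>a b. B a \<otimes> C b = C b \<otimes> B a"
    and u: "u \<in> carrier G" "scales u A (- 1)" "scales u B 0" "scales u C (- 1)"
    and v: "v \<in> carrier G" "scales v A 0" "scales v B (- 1)" "scales v C (- 1)"
    and one: "A 1 \<otimes> B 1 = C 1 \<otimes> (B 1 \<otimes> A 1)"
  shows "A a \<otimes> B b = C (a * b) \<otimes> (B b \<otimes> A a)"
proof -
  have C_neg: "C (- a) \<otimes> C a = \<one>" "C 0 = \<one>" for a
    using C[of "- a" a] C[of 0 0] by (simp_all add: r_cancel_one')
  have *: "A a \<otimes> B 1 = C a \<otimes> (B 1 \<otimes> A a)" for a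
  proof (induction a rule: dyadic_induct)
    case one
    show ?case by (fact one)
  next
    case (diff a b)
    have "A (a - b) \<otimes> B 1 \<otimes> A b = A (a - b) \<otimes> (C (- b) \<otimes> (C b \<otimes> (B 1 \<otimes> A b)))"
      using C_neg(1)[of b] by (simp add: m_assoc flip: m_assoc[of "C (- b)"])
    also have "\<dots> = C (- b) \<otimes> (A (a - b) \<otimes> A b \<otimes> B 1)"
      using left_rule[OF AC] by (simp add: diff.IH(2) m_assoc)
    also have "\<dots> = C (- b) \<otimes> C a \<otimes> (B 1 \<otimes> (A (a - b) \<otimes> A b))"
      by (simp add: diff.IH(1) m_assoc flip: A)
    also have "\<dots> = C (a - b) \<otimes> (B 1 \<otimes> A (a - b)) \<otimes> A b"
      by (simp add: m_assoc flip: C)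
    finally show ?case by simp
  next
    case (half a)
    have "A (pow2 (- 1) * a) \<otimes> B 1 \<otimes> u = u \<otimes> (A a \<otimes> B 1)"
      using u scalesD[OF u(2), of a] scalesD[OF u(3), of 1]
      by (simp add: m_assoc flip: m_assoc[of u])
    also have "\<dots> = u \<otimes> (C a \<otimes> (B 1 \<otimes> A a))"
      by (simp add: half)
    also have "\<dots> = C (pow2 (- 1) * a) \<otimes> (B 1 \<otimes> A (pow2 (- 1) * a)) \<otimes> u"
      using u left_rule[OF scalesD[OF u(4), of a]] left_rule[OF scalesD[OF u(3), of 1]] scalesD[OF u(2), of a]
      by (simp add: m_assoc)
    finally show ?case using u by simp
  qed
  show ?thesis
  proof (induction b rule: dyadic_induct)
    case one
    show ?case using * by simp
  next
    case (diff b b')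
    have "B b' \<otimes> (A a \<otimes> B (b - b')) = C (- (a * b')) \<otimes> (A a \<otimes> B b' \<otimes> B (b - b'))"
      using C_neg(1)[of "a * b'"] by (simp add: diff.IH(2) m_assoc flip: m_assoc[of "C _" "C _"])
    also have "\<dots> = C (- (a * b')) \<otimes> (A a \<otimes> B (b' + (b - b')))"
      by (simp only: B m_assoc closed)
    also have "\<dots> = C (- (a * b')) \<otimes> (C (a * b) \<otimes> (B b \<otimes> A a))"
      using diff.IH(1) by simp
    also have "\<dots> = C (a * (b - b')) \<otimes> (B (b' + (b - b')) \<otimes> A a)"
      by (simp add: algebra_simps flip: C m_assoc)
    also have "\<dots> = B b' \<otimes> (C (a * (b - b')) \<otimes> (B (b - b') \<otimes> A a))"
      using left_rule[OF BC] by (simp only: B m_assoc closed m_closed)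
    finally show ?case by simp
  next
    case (half b)
    have "A a \<otimes> B (pow2 (- 1) * b) \<otimes> v = v \<otimes> (A a \<otimes> B b)"
      using v scalesD[OF v(2), of a] scalesD[OF v(3), of b]
      by (simp add: m_assoc flip: m_assoc[of v])
    also have "\<dots> = v \<otimes> (C (a * b) \<otimes> (B b \<otimes> A a))"
      by (simp add: half)
    also have "\<dots> = C (pow2 (- 1) * (a * b)) \<otimes> (B (pow2 (- 1) * b) \<otimes> A a) \<otimes> v"
      using v left_rule[OF scalesD[OF v(4), of "a * b"]] left_rule[OF scalesD[OF v(3), of b]] scalesD[OF v(2), of a]
      by (simp add: m_assoc)
    finally show ?case using v by (simp add: ac_simps)
  qed
qed

text \<open>
  If \<open>u v u\<^sup>-\<^sup>1 = v\<^sup>2\<close>, then \<open>u\<^sup>-\<^sup>k v u\<^sup>k\<close> is a root of \<open>v\<close> of order \<open>2\<^sup>k\<close>, so that \<open>v\<close> acquires powers with dyadic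
  exponents: \<open>n / 2\<^sup>k\<close> gives \<open>u\<^sup>-\<^sup>k v\<^sup>n u\<^sup>k\<close>. The choice of the fraction does not matter under this relation.
\<close>

definition dyadic_power :: "'a \<Rightarrow> 'a \<Rightarrow> dyadic \<Rightarrow> 'a" where
  "dyadic_power u v a =
    (let (n, k) = SOME (n :: int, k :: nat). a = of_int n * pow2 (- int k)
     in inv (u [^] k) \<otimes> v [^] n \<otimes> u [^] k)"

context
  fixes u v
  assumes uv [simp]: "u \<in> carrier G" "v \<in> carrier G" and uv_rel: "u \<otimes> v = v \<otimes> (v \<otimes> u)"
begin

lemma contraction_pow: "u \<otimes> v [^] (n :: int) = v [^] (2 * n) \<otimes> u"
proof -
  interpret c: group_hom G G "\<lambda>g. u \<otimes> g \<otimes> inv u"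
    by unfold_locales (auto simp: hom_def m_assoc, simp flip: m_assoc)
  have "u \<otimes> v \<otimes> inv u = v [^] (2 :: int)"
    using int_pow_mult[of v 1 1] by (simp add: uv_rel m_assoc)
  then have "u \<otimes> v [^] n \<otimes> inv u = v [^] (2 * n)"
    using c.hom_int_pow[of v n] by (simp add: int_pow_pow)
  then show ?thesis by (metis uv inv_solve_right int_pow_closed m_closed)
qed

lemma dyadic_power_eq:
  "dyadic_power u v (of_int n * pow2 (- int k)) = inv (u [^] k) \<otimes> v [^] n \<otimes> u [^] k"
proof -
  let ?R = "\<lambda>k n. inv (u [^] (k :: nat)) \<otimes> v [^] (n :: int) \<otimes> u [^] k"
  have step: "?R (Suc k) (2 * n) = ?R k n" for k n
  proof -
    have "?R (Suc k) (2 * n) = inv (u [^] k) \<otimes> (inv u \<otimes> (v [^] (2 * n) \<otimes> u)) \<otimes> u [^] k"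
      unfolding nat_pow_Suc2[OF uv(1)] by (simp add: inv_mult_group m_assoc)
    also have "\<dots> = ?R k n"
      by (simp flip: contraction_pow add: inv_solve_left')
    finally show ?thesis .
  qed
  have expand: "?R (k + l) (2 ^ l * n) = ?R k n" for k l n
  proof (induction l)
    case (Suc l)
    have "?R (Suc (k + l)) (2 * (2 ^ l * n)) = ?R k n"
      unfolding step by (fact Suc)
    then show ?case by (simp add: mult.assoc)
  qed simp
  have unique: "?R k n = ?R l m" if "of_int n * pow2 (- int k) = of_int m * pow2 (- int l)" for k l n m
  proof -
    have "of_int n * pow2 (int l) = of_int n * pow2 (- int k) * (pow2 (int k) * pow2 (int l))"
      by (simp add: mult.assoc)
    also have "\<dots> = of_int m * pow2 (- int l) * (pow2 (int l) * pow2 (int k))"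
      by (simp only: that mult.commute[of "pow2 (int k)"])
    also have "\<dots> = of_int m * pow2 (int k)"
      by (simp add: mult.assoc)
    finally have "of_int (2 ^ l * n) = (of_int (2 ^ k * m) :: dyadic)"
      by (simp add: pow2_nat mult.commute)
    then have "2 ^ l * n = 2 ^ k * m" by (simp only: of_int_eq_iff)
    then show ?thesis using expand[of k l n] expand[of l k m] by (simp add: add.commute)
  qed
  \<comment> \<open>The fraction selected in the definition need not be the given one.\<close>
  obtain n' k' where nk: "(SOME (n' :: int, k' :: nat). of_int n * pow2 (- int k) = of_int n' * pow2 (- int k')) = (n', k')"
    by fastforce
  moreover have "case (n', k') of (n', k') \<Rightarrow> of_int n * pow2 (- int k) = of_int n' * pow2 (- int k')"
    using someI[of "\<lambda>(n', k'). of_int n * pow2 (- int k) = of_int n' * pow2 (- int k')" "(n, k)"]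
    by (simp add: nk)
  ultimately show ?thesis
    using unique[of n k n' k'] by (simp add: dyadic_power_def)
qed

lemma dyadic_power_closed [simp]: "dyadic_power u v a \<in> carrier G"
proof -
  obtain n k where "a = of_int n * pow2 (- int k)" using dyadic_fraction by blast
  then show ?thesis by (simp add: dyadic_power_eq)
qed

lemma dyadic_power_1: "dyadic_power u v 1 = v"
  using dyadic_power_eq[of 1 0] by simp

lemma dyadic_power_add: "dyadic_power u v (a + b) = dyadic_power u v a \<otimes> dyadic_power u v b"
proof -
  have common: "of_int n * pow2 (- int k) = of_int (n * 2 ^ l) * pow2 (- int (k + l))" for n k l
    using pow2_minus_cancel(2)[of "int l"] pow2_add[of "- int k" "- int l"]
    by (simp add: pow2_nat ac_simps)
  obtain n k m l where a: "a = of_int n * pow2 (- int k)" and b: "b = of_int m * pow2 (- int l)"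
    using dyadic_fraction by metis
  have a': "a = of_int (n * 2 ^ l) * pow2 (- int (k + l))"
    unfolding a by (rule common)
  have b': "b = of_int (m * 2 ^ k) * pow2 (- int (k + l))"
    unfolding b using common[of m l k] by (simp only: add.commute)
  have ab: "a + b = of_int (n * 2 ^ l + m * 2 ^ k) * pow2 (- int (k + l))"
    unfolding a' b' by (simp only: distrib_right of_int_add)
  show ?thesis
    unfolding ab unfolding a' b' dyadic_power_eq
    by (simp add: int_pow_mult m_assoc) (simp flip: m_assoc)
qed

lemma scales_dyadic_power: "scales u (dyadic_power u v) 1"
  unfolding scales_def
proof
  fix a
  obtain n k where a: "a = of_int n * pow2 (- int k)" using dyadic_fraction by blast
  have a': "pow2 1 * a = of_int (2 * n) * pow2 (- int k)"
    unfolding a by (simp add: pow2_1)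
  have u: "u \<otimes> u [^] k = u [^] k \<otimes> u"
    using nat_pow_Suc2[of u k] by simp
  have "u [^] k \<otimes> (u \<otimes> inv (u [^] k)) = u \<otimes> u [^] k \<otimes> inv (u [^] k)"
    by (simp add: u m_assoc)
  then have *: "u \<otimes> inv (u [^] k) = inv (u [^] k) \<otimes> u"
    by (simp add: inv_solve_left m_assoc)
  have "u \<otimes> (inv (u [^] k) \<otimes> v [^] n \<otimes> u [^] k) = inv (u [^] k) \<otimes> (u \<otimes> v [^] n) \<otimes> u [^] k"
    using * by (simp flip: m_assoc)
  also have "\<dots> = inv (u [^] k) \<otimes> v [^] (2 * n) \<otimes> u [^] k \<otimes> u"
    by (simp add: contraction_pow m_assoc u)
  finally show "u \<otimes> dyadic_power u v a = dyadic_power u v (pow2 1 * a) \<otimes> u"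
    unfolding a' unfolding a dyadic_power_eq .
qed

lemma scales_dyadic_power_0:
  assumes [simp]: "g \<in> carrier G" and gu: "g \<otimes> u = u \<otimes> g" and gv: "g \<otimes> v = v \<otimes> g"
  shows "scales g (dyadic_power u v) 0"
proof -
  have "g \<otimes> dyadic_power u v a = dyadic_power u v a \<otimes> g" for a
  proof -
    interpret c: group_hom G G "\<lambda>x. g \<otimes> x \<otimes> inv g"
      by unfold_locales (auto simp: hom_def m_assoc, simp flip: m_assoc)
    have fixed: "g \<otimes> u \<otimes> inv g = u" "g \<otimes> v \<otimes> inv g = v"
      by (simp_all add: gu gv m_assoc)
    obtain n k where a: "a = of_int n * pow2 (- int k)" using dyadic_fraction by blast
    have "g \<otimes> (inv (u [^] k) \<otimes> v [^] n \<otimes> u [^] k) \<otimes> inv g = inv (u [^] k) \<otimes> v [^] n \<otimes> u [^] k"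
      using c.hom_mult[of "inv (u [^] k) \<otimes> v [^] n" "u [^] k"] c.hom_mult[of "inv (u [^] k)" "v [^] n"]
        c.hom_inv[of "u [^] k"] c.hom_nat_pow[of u k] c.hom_int_pow[of v n]
      by (simp add: fixed)
    then show ?thesis unfolding a dyadic_power_eq
      by (metis assms(1) inv_solve_right dyadic_power_closed dyadic_power_eq m_closed)
  qed
  then show ?thesis by (simp add: scales_def)
qed

end

end

section \<open>A finite presentation\<close>

lemma (in group) commuting_commutator:
  assumes [simp]: "g \<in> carrier G" "u \<in> carrier G" "v \<in> carrier G"
    and "g \<otimes> u = u \<otimes> g" "g \<otimes> v = v \<otimes> g"
  shows "g \<otimes> (u \<otimes> v \<otimes> inv (v \<otimes> u)) = u \<otimes> v \<otimes> inv (v \<otimes> u) \<otimes> g"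
proof -
  interpret c: group_hom G G "\<lambda>x. g \<otimes> x \<otimes> inv g"
    by unfold_locales (auto simp: hom_def m_assoc, simp flip: m_assoc)
  have fixed: "g \<otimes> u \<otimes> inv g = u" "g \<otimes> v \<otimes> inv g = v"
    using assms(4,5) by (simp_all add: m_assoc)
  have "g \<otimes> (u \<otimes> v \<otimes> inv (v \<otimes> u)) \<otimes> inv g = u \<otimes> v \<otimes> inv (v \<otimes> u)"
    by (simp only: c.hom_mult c.hom_inv fixed m_closed inv_closed assms(1-3))
  then show ?thesis
    using inv_solve_right'[of "u \<otimes> v \<otimes> inv (v \<otimes> u)" "g \<otimes> (u \<otimes> v \<otimes> inv (v \<otimes> u))" g] by simp
qed

lemma (in group) inv_contraction: "a \<in> carrier G \<Longrightarrow> u \<in> carrier G \<Longrightarrow> a \<otimes> u = u \<otimes> (a \<otimes> a) \<Longrightarrow>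
    inv u \<otimes> a = a \<otimes> (a \<otimes> inv u)"
proof -
  assume [simp]: "a \<in> carrier G" "u \<in> carrier G" and "a \<otimes> u = u \<otimes> (a \<otimes> a)"
  have "inv u \<otimes> a = inv u \<otimes> (a \<otimes> u) \<otimes> inv u" by (simp add: m_assoc)
  also have "\<dots> = a \<otimes> a \<otimes> inv u" using \<open>a \<otimes> u = _\<close> by (simp flip: m_assoc)
  finally show ?thesis by (simp add: m_assoc)
qed

lemma (in group) inv_commute: "a \<in> carrier G \<Longrightarrow> u \<in> carrier G \<Longrightarrow> a \<otimes> u = u \<otimes> a \<Longrightarrow> a \<otimes> inv u = inv u \<otimes> a"
  by (simp add: inv_solve_left m_assoc) (simp flip: m_assoc add: inv_solve_right)

text \<open>
  The generators correspond to the elementary matrices \<open>1 + E\<^sub>1\<^sub>2\<close>, \<open>1 + E\<^sub>2\<^sub>3\<close>, \<open>1 + E\<^sub>3\<^sub>4\<close>, \<open>1 + E\<^sub>1\<^sub>3\<close>, \<open>1 + E\<^sub>2\<^sub>4\<close> and to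
  \<open>s = diag(1, 2, 1, 1)\<close>, \<open>t = diag(1, 1, 2, 1)\<close>. All relations are equations between positive words. All but
  the last one hold in Abels' group; the last one says that the corner entry \<open>1\<close> is trivial.
\<close>

locale abels_relations = group G for G (structure) +
  fixes g12 g23 g34 g13 g24 s t
  assumes gens [simp]: "g12 \<in> carrier G" "g23 \<in> carrier G" "g34 \<in> carrier G" "g13 \<in> carrier G"
      "g24 \<in> carrier G" "s \<in> carrier G" "t \<in> carrier G"
    and rel_s_t: "s \<otimes> t = t \<otimes> s"
    and rel_12_s: "g12 \<otimes> s = s \<otimes> (g12 \<otimes> g12)" and rel_12_t: "g12 \<otimes> t = t \<otimes> g12"
    and rel_s_23: "s \<otimes> g23 = g23 \<otimes> (g23 \<otimes> s)" and rel_23_t: "g23 \<otimes> t = t \<otimes> (g23 \<otimes> g23)"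
    and rel_s_34: "s \<otimes> g34 = g34 \<otimes> s" and rel_t_34: "t \<otimes> g34 = g34 \<otimes> (g34 \<otimes> t)"
    and rel_s_13: "s \<otimes> g13 = g13 \<otimes> s" and rel_13_t: "g13 \<otimes> t = t \<otimes> (g13 \<otimes> g13)"
    and rel_s_24: "s \<otimes> g24 = g24 \<otimes> (g24 \<otimes> s)" and rel_t_24: "t \<otimes> g24 = g24 \<otimes> t"
    and rel_12_34: "g12 \<otimes> g34 = g34 \<otimes> g12" and rel_12_13: "g12 \<otimes> g13 = g13 \<otimes> g12" and rel_13_23: "g13 \<otimes> g23 = g23 \<otimes> g13"
    and rel_23_24: "g23 \<otimes> g24 = g24 \<otimes> g23" and rel_24_34: "g24 \<otimes> g34 = g34 \<otimes> g24" and rel_13_24: "g13 \<otimes> g24 = g24 \<otimes> g13"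
    and rel_12_23: "g12 \<otimes> g23 = g13 \<otimes> (g23 \<otimes> g12)" and rel_23_34: "g23 \<otimes> g34 = g24 \<otimes> (g34 \<otimes> g23)"
    and rel_12_24: "g12 \<otimes> g24 = g24 \<otimes> g12"
begin

text \<open>
  In the matrix group, conjugation by the first argument doubles the entry at the position of the second
  one.
\<close>

abbreviation "X12 \<equiv> dyadic_power (inv s) g12"
abbreviation "X23 \<equiv> dyadic_power s g23"
abbreviation "X34 \<equiv> dyadic_power t g34"
abbreviation "X13 \<equiv> dyadic_power (inv t) g13"
abbreviation "X24 \<equiv> dyadic_power s g24"
abbreviation "T i j \<equiv> s [^] (i :: int) \<otimes> t [^] (j :: int)"

lemmas contractions [simp] =
  inv_contraction[OF gens(1,6) rel_12_s] inv_contraction[OF gens(4,7) rel_13_t]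

lemma power_1 [simp]: "X12 1 = g12" "X23 1 = g23" "X34 1 = g34" "X13 1 = g13" "X24 1 = g24"
  using contractions rel_s_23 rel_t_34 rel_s_24 by (simp_all add: dyadic_power_1)

lemma closed [simp]: "X12 a \<in> carrier G" "X23 a \<in> carrier G" "X34 a \<in> carrier G"
  "X13 a \<in> carrier G" "X24 a \<in> carrier G"
  using contractions rel_s_23 rel_t_34 rel_s_24 by (simp_all add: dyadic_power_closed)

lemma power_add: "X12 (a + b) = X12 a \<otimes> X12 b" "X23 (a + b) = X23 a \<otimes> X23 b"
  "X34 (a + b) = X34 a \<otimes> X34 b"
  "X13 (a + b) = X13 a \<otimes> X13 b" "X24 (a + b) = X24 a \<otimes> X24 b"
  using contractions rel_s_23 rel_t_34 rel_s_24 by (simp_all add: dyadic_power_add)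

lemma power_0 [simp]: "X12 0 = \<one>" "X23 0 = \<one>" "X34 0 = \<one>" "X13 0 = \<one>" "X24 0 = \<one>"
  using power_add[of 0 0] by simp_all

lemma scales_s: "scales s X12 (- 1)" "scales s X23 1" "scales s X34 0" "scales s X13 0" "scales s X24 1"
proof -
  show "scales s X23 1" "scales s X24 1"
    using rel_s_23 rel_s_24 by (simp_all add: scales_dyadic_power)
  show "scales s X12 (- 1)"
    using scales_inv[OF scales_dyadic_power, of "inv s" g12] contractions by simp
  show "scales s X34 0" "scales s X13 0"
    using rel_s_34 rel_s_13 rel_s_t rel_t_34 contractions by (auto intro!: scales_dyadic_power_0 inv_commute)
qed

lemma scales_t: "scales t X12 0" "scales t X23 (- 1)" "scales t X34 1" "scales t X13 (- 1)" "scales t X24 0"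
proof -
  show "scales t X34 1"
    using rel_t_34 by (simp_all add: scales_dyadic_power)
  show "scales t X13 (- 1)"
    using scales_inv[OF scales_dyadic_power, of "inv t" g13] contractions by simp
  show "scales t X12 0" "scales t X24 0"
    using rel_12_t rel_t_24 rel_s_t rel_s_24 contractions by (auto intro!: scales_dyadic_power_0 inv_commute)
  \<comment> \<open>\<open>X23\<close> is built from \<open>s\<close>; the effect of \<open>t\<close> on it follows because \<open>s t\<close> commutes with both
    \<open>g23\<close> and \<open>s\<close>.\<close>
  have "s \<otimes> t \<otimes> g23 = t \<otimes> (s \<otimes> g23)" by (simp add: rel_s_t m_assoc)
  also have "\<dots> = t \<otimes> (g23 \<otimes> g23) \<otimes> s" by (simp add: rel_s_23 m_assoc)
  also have "\<dots> = g23 \<otimes> (t \<otimes> s)" by (simp add: m_assoc flip: rel_23_t)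
  finally have "s \<otimes> t \<otimes> g23 = g23 \<otimes> (s \<otimes> t)" by (simp add: rel_s_t)
  moreover have "s \<otimes> t \<otimes> s = s \<otimes> (s \<otimes> t)" by (simp add: m_assoc flip: rel_s_t)
  ultimately have "scales (s \<otimes> t) X23 0"
    using rel_s_23 by (intro scales_dyadic_power_0) simp_all
  then have "scales (inv s \<otimes> (s \<otimes> t)) X23 (- 1 + 0)"
    by (intro scales_mult scales_inv scales_s) simp_all
  then show "scales t X23 (- 1)" by (simp flip: m_assoc)
qed

text \<open>
  As linear forms in \<open>(i, j)\<close>, the exponents are opposite to each other for the pairs of positions
  \<open>(12, 24)\<close> and \<open>(13, 34)\<close>, and linearly independent for all other pairs.
\<close>

lemma scales_T: "scales (T i j) X12 (- i)" "scales (T i j) X23 (i - j)" "scales (T i j) X34 j"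
  "scales (T i j) X13 (- j)" "scales (T i j) X24 i"
proof -
  have "scales (T i j) P (i * k + j * l)" if "scales s P k" "scales t P l" "\<And>a. P a \<in> carrier G" for P k l
    using that by (intro scales_mult scales_int_pow) simp_all
  from this[OF scales_s(1) scales_t(1)] this[OF scales_s(2) scales_t(2)] this[OF scales_s(3) scales_t(3)]
    this[OF scales_s(4) scales_t(4)] this[OF scales_s(5) scales_t(5)]
  show "scales (T i j) X12 (- i)" "scales (T i j) X23 (i - j)" "scales (T i j) X34 j"
    "scales (T i j) X13 (- j)" "scales (T i j) X24 i" by simp_all
qed

lemma commuting_one_parameter:
  assumes "\<And>a. P a \<in> carrier G" "\<And>a. Q a \<in> carrier G"
    and "\<And>a b. P (a + b) = P a \<otimes> P b" "\<And>a b. Q (a + b) = Q a \<otimes> Q b"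
    and "scales (T i j) P (- 1)" "scales (T i j) Q 0" "scales (T k l) P 0" "scales (T k l) Q (- 1)"
    and "P 1 \<otimes> Q 1 = Q 1 \<otimes> P 1"
  shows "P a \<otimes> Q b = Q b \<otimes> P a"
  using bilinear_commutation[of P Q "\<lambda>_. \<one>" "T i j" "T k l" a b] assms by (simp add: scales_def)

text \<open>
  The integers passed to the rule in each of the next proofs are the exponents of a diagonal element
  that halves the first parameter and fixes the second one, followed by the exponents of a diagonal
  element with exchanged roles.
\<close>

lemma commute_12_34: "X12 a \<otimes> X34 b = X34 b \<otimes> X12 a"
  by (rule commuting_one_parameter[of X12 X34 1 0 0 "- 1"])
     (use scales_T[of 1 0] scales_T[of 0 "- 1"] in \<open>simp_all add: power_add rel_12_34\<close>)

lemma commute_12_13: "X12 a \<otimes> X13 b = X13 b \<otimes> X12 a"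
  by (rule commuting_one_parameter[of X12 X13 1 0 0 1])
     (use scales_T[of 1 0] scales_T[of 0 1] in \<open>simp_all add: power_add rel_12_13\<close>)

lemma commute_13_23: "X13 a \<otimes> X23 b = X23 b \<otimes> X13 a"
  by (rule commuting_one_parameter[of X13 X23 1 1 "- 1" 0])
     (use scales_T[of 1 1] scales_T[of "- 1" 0] in \<open>simp_all add: power_add rel_13_23\<close>)

lemma commute_13_24: "X13 a \<otimes> X24 b = X24 b \<otimes> X13 a"
  by (rule commuting_one_parameter[of X13 X24 0 1 "- 1" 0])
     (use scales_T[of 0 1] scales_T[of "- 1" 0] in \<open>simp_all add: power_add rel_13_24\<close>)

lemma commute_24_23: "X24 a \<otimes> X23 b = X23 b \<otimes> X24 a"
  by (rule commuting_one_parameter[of X24 X23 "- 1" "- 1" 0 1])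
     (use scales_T[of "- 1" "- 1"] scales_T[of 0 1] in \<open>simp_all add: power_add rel_23_24\<close>)

lemma commute_24_34: "X24 a \<otimes> X34 b = X34 b \<otimes> X24 a"
  by (rule commuting_one_parameter[of X24 X34 "- 1" 0 0 "- 1"])
     (use scales_T[of "- 1" 0] scales_T[of 0 "- 1"] in \<open>simp_all add: power_add rel_24_34\<close>)

lemma mult_12_23: "X12 a \<otimes> X23 b = X13 (a * b) \<otimes> (X23 b \<otimes> X12 a)"
  by (rule bilinear_commutation[of X12 X23 X13 "T 1 1" "T 0 1"])
     (use scales_T[of 1 1] scales_T[of 0 1] in \<open>simp_all add: power_add rel_12_23 commute_12_13 commute_13_23\<close>)

lemma mult_23_34: "X23 a \<otimes> X34 b = X24 (a * b) \<otimes> (X34 b \<otimes> X23 a)"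
  by (rule bilinear_commutation[of X23 X34 X24 "T (- 1) 0" "T (- 1) (- 1)"])
     (use scales_T[of "- 1" 0] scales_T[of "- 1" "- 1"] in \<open>simp_all add: power_add rel_23_34 commute_24_23 commute_24_34\<close>)

text \<open>
  No diagonal element contracts the corner, so the corner subgroup is defined by commutators instead.
\<close>

definition X14 :: "dyadic \<Rightarrow> 'a" where
  "X14 a = g12 \<otimes> X24 a \<otimes> inv (X24 a \<otimes> g12)"

lemma X14_closed [simp]: "X14 a \<in> carrier G"
  by (simp add: X14_def)

text \<open>
  The product \<open>X12 a \<cdot> X23 b \<cdot> X34 c\<close> is reversed in two ways, starting with its last two or with its first
  two factors. The former produces the commutator of the positions \<open>12\<close> and \<open>24\<close>, the latter that of \<open>13\<close>
  and \<open>34\<close>.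
\<close>

lemma triple_commutator:
  "X13 (a * b) \<otimes> X34 c \<otimes> inv (X34 c \<otimes> X13 (a * b)) =
    X12 a \<otimes> X24 (b * c) \<otimes> inv (X24 (b * c) \<otimes> X12 a)"
proof -
  let ?F = "X13 (a * b) \<otimes> X34 c \<otimes> inv (X34 c \<otimes> X13 (a * b))"
  let ?H = "X12 a \<otimes> X24 (b * c) \<otimes> inv (X24 (b * c) \<otimes> X12 a)"
  have F: "X13 (a * b) \<otimes> X34 c = ?F \<otimes> (X34 c \<otimes> X13 (a * b))" by (simp add: m_assoc)
  have H: "X12 a \<otimes> X24 (b * c) = ?H \<otimes> (X24 (b * c) \<otimes> X12 a)" by (simp add: m_assoc)
  have [simp]: "?F \<in> carrier G" "?H \<in> carrier G" by simp_all
  note [simp del] = inv_mult_group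
  have EF: "X24 (b * c) \<otimes> ?F = ?F \<otimes> X24 (b * c)"
    by (rule commuting_commutator) (simp_all add: commute_13_24 commute_24_34)
  have "X12 a \<otimes> (X23 b \<otimes> X34 c) = ?H \<otimes> X24 (b * c) \<otimes> (X34 c \<otimes> X13 (a * b)) \<otimes> (X23 b \<otimes> X12 a)"
  proof -
    have "X12 a \<otimes> (X23 b \<otimes> X34 c) = X12 a \<otimes> X24 (b * c) \<otimes> (X34 c \<otimes> X23 b)"
      by (simp add: mult_23_34 m_assoc)
    also have "\<dots> = ?H \<otimes> X24 (b * c) \<otimes> (X12 a \<otimes> X34 c) \<otimes> X23 b"
      by (subst H) (simp only: m_assoc closed m_closed \<open>?H \<in> carrier G\<close>)
    also have "\<dots> = ?H \<otimes> X24 (b * c) \<otimes> X34 c \<otimes> (X12 a \<otimes> X23 b)"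
      by (simp only: commute_12_34 m_assoc closed m_closed \<open>?H \<in> carrier G\<close>)
    also have "\<dots> = ?H \<otimes> X24 (b * c) \<otimes> (X34 c \<otimes> X13 (a * b)) \<otimes> (X23 b \<otimes> X12 a)"
      by (simp only: mult_12_23 m_assoc closed m_closed \<open>?H \<in> carrier G\<close>)
    finally show ?thesis .
  qed
  moreover have "X12 a \<otimes> X23 b \<otimes> X34 c = ?F \<otimes> X24 (b * c) \<otimes> (X34 c \<otimes> X13 (a * b)) \<otimes> (X23 b \<otimes> X12 a)"
  proof -
    have "X12 a \<otimes> X23 b \<otimes> X34 c = X13 (a * b) \<otimes> (X23 b \<otimes> X34 c) \<otimes> X12 a"
      by (simp add: mult_12_23 commute_12_34 m_assoc)
    also have "\<dots> = X24 (b * c) \<otimes> (X13 (a * b) \<otimes> X34 c) \<otimes> (X23 b \<otimes> X12 a)"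
      by (simp add: mult_23_34 m_assoc left_rule[OF commute_13_24])
    also have "\<dots> = X24 (b * c) \<otimes> ?F \<otimes> (X34 c \<otimes> X13 (a * b)) \<otimes> (X23 b \<otimes> X12 a)"
      by (subst F) (simp only: m_assoc closed m_closed \<open>?F \<in> carrier G\<close>)
    finally show ?thesis by (simp only: EF)
  qed
  ultimately have "?H \<otimes> X24 (b * c) \<otimes> (X34 c \<otimes> X13 (a * b)) \<otimes> (X23 b \<otimes> X12 a) =
      ?F \<otimes> X24 (b * c) \<otimes> (X34 c \<otimes> X13 (a * b)) \<otimes> (X23 b \<otimes> X12 a)"
    by (simp add: m_assoc)
  then show ?thesis by simp
qed

text \<open>
  By \<open>triple_commutator\<close> the commutators of both kinds are unchanged when a factor moves from one
  parameter to the other, so they depend only on the product of the parameters.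
\<close>

lemma mult_13_34: "X13 a \<otimes> X34 b = X14 (a * b) \<otimes> (X34 b \<otimes> X13 a)"
  and mult_12_24: "X12 a \<otimes> X24 b = X14 (a * b) \<otimes> (X24 b \<otimes> X12 a)"
  and X14_eq: "X14 a = X13 a \<otimes> g34 \<otimes> inv (g34 \<otimes> X13 a)"
proof -
  have F: "X13 a \<otimes> X34 c \<otimes> inv (X34 c \<otimes> X13 a) = X14 (a * c)" for a c
    using triple_commutator[of 1 a c] by (simp add: X14_def)
  have H: "X12 a \<otimes> X24 c \<otimes> inv (X24 c \<otimes> X12 a) = X14 (a * c)" for a c
    using triple_commutator[of a 1 c] F[of a c] by simp
  show "X13 a \<otimes> X34 b = X14 (a * b) \<otimes> (X34 b \<otimes> X13 a)"
    by (simp add: m_assoc flip: F)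
  show "X12 a \<otimes> X24 b = X14 (a * b) \<otimes> (X24 b \<otimes> X12 a)"
    by (simp add: m_assoc flip: H)
  show "X14 a = X13 a \<otimes> g34 \<otimes> inv (g34 \<otimes> X13 a)" using F[of a 1] by simp
qed

text \<open>
  The corner elements have two descriptions as commutators, \<open>X14_def\<close> and \<open>X14_eq\<close>. Except for \<open>X23\<close>, each
  one-parameter subgroup commutes with both entries of one of these two, hence with the corner.
\<close>

lemma commute_12_14: "X12 b \<otimes> X14 a = X14 a \<otimes> X12 b" unfolding X14_eq
  using commute_12_13 commute_12_34[of b 1] by (intro commuting_commutator) simp_all

lemma commute_24_14: "X24 b \<otimes> X14 a = X14 a \<otimes> X24 b" unfolding X14_eq
  using commute_13_24 commute_24_34[of b 1] by (intro commuting_commutator) simp_all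

lemma commute_13_14: "X13 b \<otimes> X14 a = X14 a \<otimes> X13 b" unfolding X14_def
  using commute_13_24 commute_12_13[of 1 b] by (intro commuting_commutator) simp_all

lemma commute_34_14: "X34 b \<otimes> X14 a = X14 a \<otimes> X34 b" unfolding X14_def
  using commute_24_34 commute_12_34[of 1 b] by (intro commuting_commutator) simp_all

text \<open>
  Conjugation by \<open>X23\<close> changes \<open>g34\<close> by an element of \<open>X24\<close>, which commutes with \<open>X13\<close>, so the commutator
  of \<open>X13\<close> and \<open>g34\<close> stays the same.
\<close>

lemma commute_23_14: "X23 b \<otimes> X14 a = X14 a \<otimes> X23 b"
proof -
  have 1: "X13 a \<otimes> g34 = X14 a \<otimes> (g34 \<otimes> X13 a)" using mult_13_34[of a 1] by simp
  have 2: "X23 b \<otimes> g34 = X24 b \<otimes> (g34 \<otimes> X23 b)" using mult_23_34[of b 1] by simp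
  have "X23 b \<otimes> X14 a \<otimes> (g34 \<otimes> X13 a) = X23 b \<otimes> (X13 a \<otimes> g34)" by (simp add: m_assoc 1)
  also have "\<dots> = X13 a \<otimes> (X23 b \<otimes> g34)" by (simp add: commute_13_23 flip: m_assoc)
  also have "\<dots> = X24 b \<otimes> (X13 a \<otimes> g34 \<otimes> X23 b)" by (simp add: 2 commute_13_24 m_assoc left_rule[OF commute_13_24])
  also have "\<dots> = X14 a \<otimes> (X24 b \<otimes> g34 \<otimes> (X13 a \<otimes> X23 b))" by (simp add: 1 m_assoc left_rule[OF commute_24_14])
  also have "\<dots> = X14 a \<otimes> (X24 b \<otimes> g34 \<otimes> X23 b) \<otimes> X13 a" by (simp add: commute_13_23 m_assoc)
  also have "\<dots> = X14 a \<otimes> X23 b \<otimes> (g34 \<otimes> X13 a)" by (simp add: 2 m_assoc flip: m_assoc[of "X23 b" g34])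
  finally show ?thesis by simp
qed

lemma X14_add: "X14 (a + b) = X14 a \<otimes> X14 b"
proof -
  have 1: "g12 \<otimes> X24 a = X14 a \<otimes> (X24 a \<otimes> g12)" for a using mult_12_24[of 1 a] by simp
  have "X14 (a + b) \<otimes> (X24 a \<otimes> X24 b \<otimes> g12) = g12 \<otimes> X24 a \<otimes> X24 b"
    using 1[of "a + b"] by (simp add: power_add m_assoc)
  also have "\<dots> = X14 a \<otimes> X14 b \<otimes> (X24 a \<otimes> X24 b \<otimes> g12)"
    by (simp add: 1 m_assoc left_rule[OF commute_24_14])
  finally show ?thesis by simp
qed

lemma X14_of_int: "X14 (of_int n) = \<one>"
proof -
  have 0: "X14 0 = \<one>" using X14_add[of 0 0] by simp
  have 1: "X14 1 = \<one>" using rel_12_24 by (simp add: X14_def)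
  show ?thesis
  proof (induction n rule: int_induct[of _ 0])
    case (step2 i)
    then show ?case using X14_add[of "of_int (i - 1)" 1] by (simp add: 1)
  qed (simp_all add: 0 1 X14_add)
qed

text \<open>
  The factors are grouped by the columns of the matrix, the last column coming first. In this order the
  parameters are exactly the entries of the product.
\<close>

fun assemble :: "abels \<Rightarrow> 'a" where
  "assemble (Abels a b c d' e' f i j) = X14 f \<otimes> (X24 e' \<otimes> (X34 c \<otimes> (X13 d' \<otimes> (X23 b \<otimes> (X12 a \<otimes> T i j)))))"

lemma T_mult: "T i j \<otimes> s = T (i + 1) j" "T i j \<otimes> t = T i (j + 1)"
proof -
  have "scales t (\<lambda>_. s) 0" by (simp add: scales_def rel_s_t)
  then have "scales (t [^] j) (\<lambda>_. s) (j * 0)" by (rule scales_int_pow) simp_all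
  then have "t [^] j \<otimes> s = s \<otimes> t [^] j" by (simp add: scales_def)
  then show "T i j \<otimes> s = T (i + 1) j" by (simp add: m_assoc int_pow_mult)
  show "T i j \<otimes> t = T i (j + 1)" by (simp add: m_assoc int_pow_mult)
qed

text \<open>
  Rewriting with these rules moves the one-parameter subgroups into the order used by \<open>assemble\<close>.
\<close>

lemmas sort_rules =
  commute_12_34 commute_12_13 commute_13_23[symmetric] commute_13_24
  commute_24_23[symmetric] commute_24_34[symmetric] mult_12_23 mult_23_34 mult_13_34 mult_12_24
  commute_12_14 commute_24_14 commute_13_14 commute_34_14 commute_23_14

lemmas merge_rules = power_add[symmetric] X14_add[symmetric]

lemmas normal_form_rules =
  sort_rules merge_rules sort_rules[THEN left_rule] merge_rules[THEN left_rule]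

text \<open>
  It suffices to multiply by generators on the right: then \<open>assemble\<close> turns the value of any word in
  Abels' group into its value in \<open>G\<close>, so a relation between words that holds in Abels' group holds in
  \<open>G\<close>.
\<close>

lemma assemble_mult:
  "assemble (abels_mult g (Abels 1 0 0 0 0 0 0 0)) = assemble g \<otimes> g12"
  "assemble (abels_mult g (Abels 0 1 0 0 0 0 0 0)) = assemble g \<otimes> g23"
  "assemble (abels_mult g (Abels 0 0 1 0 0 0 0 0)) = assemble g \<otimes> g34"
  "assemble (abels_mult g (Abels 0 0 0 1 0 0 0 0)) = assemble g \<otimes> g13"
  "assemble (abels_mult g (Abels 0 0 0 0 1 0 0 0)) = assemble g \<otimes> g24"
  "assemble (abels_mult g (Abels 0 0 0 0 0 0 1 0)) = assemble g \<otimes> s"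
  "assemble (abels_mult g (Abels 0 0 0 0 0 0 0 1)) = assemble g \<otimes> t"
proof -
  obtain a b c d' e' f i j where g: "g = Abels a b c d' e' f i j" by (cases g)
  note push = scales_T[THEN scalesD, of i j 1, simplified]
  show "assemble (abels_mult g (Abels 1 0 0 0 0 0 0 0)) = assemble g \<otimes> g12"
    using push(1) by (simp add: g m_assoc normal_form_rules)
  show "assemble (abels_mult g (Abels 0 1 0 0 0 0 0 0)) = assemble g \<otimes> g23"
    using push(2) by (simp add: g m_assoc normal_form_rules)
  show "assemble (abels_mult g (Abels 0 0 1 0 0 0 0 0)) = assemble g \<otimes> g34"
    using push(3) by (simp add: g m_assoc normal_form_rules)
  show "assemble (abels_mult g (Abels 0 0 0 1 0 0 0 0)) = assemble g \<otimes> g13"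
    using push(4) by (simp add: g m_assoc normal_form_rules)
  show "assemble (abels_mult g (Abels 0 0 0 0 1 0 0 0)) = assemble g \<otimes> g24"
    using push(5) by (simp add: g m_assoc normal_form_rules)
  show "assemble (abels_mult g (Abels 0 0 0 0 0 0 1 0)) = assemble g \<otimes> s"
    using T_mult(1) by (simp add: g m_assoc)
  show "assemble (abels_mult g (Abels 0 0 0 0 0 0 0 1)) = assemble g \<otimes> t"
    using T_mult(2) by (simp add: g m_assoc)
qed

end

section \<open>Isolation\<close>

definition abels_gens :: "abels list" where
  "abels_gens = [Abels 1 0 0 0 0 0 0 0, Abels 0 1 0 0 0 0 0 0, Abels 0 0 1 0 0 0 0 0,
    Abels 0 0 0 1 0 0 0 0, Abels 0 0 0 0 1 0 0 0, Abels 0 0 0 0 0 0 1 0, Abels 0 0 0 0 0 0 0 1]"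

text \<open>
  The equations of the locale \<open>abels_relations\<close>, for the generators numbered as in \<open>abels_gens\<close>.
\<close>

definition abels_relators :: "(nat list \<times> nat list) list" where
  "abels_relators =
    [([5, 6], [6, 5]),
     ([0, 5], [5, 0, 0]), ([0, 6], [6, 0]),
     ([5, 1], [1, 1, 5]), ([1, 6], [6, 1, 1]),
     ([5, 2], [2, 5]), ([6, 2], [2, 2, 6]),
     ([5, 3], [3, 5]), ([3, 6], [6, 3, 3]),
     ([5, 4], [4, 4, 5]), ([6, 4], [4, 6]),
     ([0, 2], [2, 0]), ([0, 3], [3, 0]), ([3, 1], [1, 3]),
     ([1, 4], [4, 1]), ([4, 2], [2, 4]), ([3, 4], [4, 3]),
     ([0, 1], [3, 1, 0]), ([1, 2], [4, 2, 1]), ([0, 4], [4, 0])]"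

definition positive_word :: "nat list \<Rightarrow> letter list" where
  "positive_word = map (Pair False)"

abbreviation abels_eval :: "letter list \<Rightarrow> abels" where
  "abels_eval \<equiv> word_val abels_group (\<lambda>i. abels_gens ! i)"

lemma less_7: "i < 7 \<longleftrightarrow> i \<in> {0, 1, 2, 3, 4, 5, 6 :: nat}"
  by auto

lemma positive_word_carrier: "set u \<subseteq> {..<m} \<Longrightarrow> positive_word u \<in> carrier (free_group m)"
proof -
  have "reduced_word (positive_word u)"
    by (induction u rule: induct_list012) (auto simp: positive_word_def inv_letter_def)
  moreover assume "set u \<subseteq> {..<m}"
  ultimately show ?thesis by (auto simp: free_group_def positive_word_def)
qed

lemma abels_relations_hold:
  assumes "(u, v) \<in> set abels_relators"
  shows "abels_eval (positive_word u) = abels_eval (positive_word v) \<or>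
    abels_eval (positive_word u) = abels_mult (Abels 0 0 0 0 0 1 0 0) (abels_eval (positive_word v))"
proof -
  have "pow2 (- 1) * 2 = 1"
    using pow2_minus_cancel(1)[of 1] by (simp only: pow2_1)
  then show ?thesis
    using assms unfolding abels_relators_def
    by (auto simp: positive_word_def word_val_def letter_val_def abels_gens_def pow2_1)
qed

text \<open>
  The group generated by \<open>y\<close> is a quotient of \<open>A/Z\<close> as soon as the finitely many relations hold for \<open>y\<close>.
\<close>

lemma abels_relators_present:
  assumes "group Q" and y: "\<And>i. i < 7 \<Longrightarrow> y i \<in> carrier Q"
    and rel: "\<And>u v. (u, v) \<in> set abels_relators \<Longrightarrow>
      word_val Q y (positive_word u) = word_val Q y (positive_word v)"
    and w: "set w \<subseteq> UNIV \<times> {..<7}" "abels_eval w \<in> central_ints"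
  shows "word_val Q y w = \<one>\<^bsub>Q\<^esub>"
proof -
  interpret group Q by fact
  have [simp]: "y 0 \<in> carrier Q" "y (Suc 0) \<in> carrier Q" "y 2 \<in> carrier Q" "y 3 \<in> carrier Q"
    "y 4 \<in> carrier Q" "y 5 \<in> carrier Q" "y 6 \<in> carrier Q"
    by (simp_all add: y)
  have rels: "\<forall>(u, v) \<in> set abels_relators.
      word_val Q y (positive_word u) = word_val Q y (positive_word v)"
    using rel by blast
  note equations = rels[unfolded abels_relators_def positive_word_def
      word_val_def letter_val_def, simplified]
  interpret abels_relations Q "y 0" "y (Suc 0)" "y 2" "y 3" "y 4" "y 5" "y 6"
  proof unfold_locales
  qed (use equations in \<open>blast | simp\<close>)+
  have gen: "assemble (abels_mult g (abels_gens ! i)) = assemble g \<otimes>\<^bsub>Q\<^esub> y i" if "i < 7" for g i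
    using that assemble_mult[of g] unfolding less_7 by (auto simp: abels_gens_def)
  have closed: "assemble g \<in> carrier Q" for g by (cases g) simp
  have letter: "assemble (abels_mult g (letter_val abels_group (\<lambda>i. abels_gens ! i) a)) =
      assemble g \<otimes>\<^bsub>Q\<^esub> letter_val Q y a" if "snd a < 7" for g a
  proof (cases "fst a")
    case True
    let ?k = "abels_gens ! snd a"
    have "abels_mult (abels_mult g (abels_inv ?k)) ?k = g"
      using Ab.m_assoc[of g "abels_inv ?k" ?k] Ab.l_inv[of ?k] Ab.r_one[of g] by simp
    then have "assemble g = assemble (abels_mult g (abels_inv ?k)) \<otimes>\<^bsub>Q\<^esub> y (snd a)"
      using gen[OF that, of "abels_mult g (abels_inv ?k)"] by simp
    then show ?thesis
      using True closed y[OF that] by (simp add: letter_val_def inv_solve_right)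
  qed (use gen that in \<open>simp add: letter_val_def\<close>)
  have val_closed: "word_val Q y w \<in> carrier Q" if "set w \<subseteq> UNIV \<times> {..<7}" for w
    using that y by (induction w) (auto simp: word_val_def letter_val_def)
  have "assemble (abels_mult g (abels_eval w)) = assemble g \<otimes>\<^bsub>Q\<^esub> word_val Q y w" for g
    using w(1)
  proof (induction w arbitrary: g)
    case Nil
    then show ?case using closed Ab.r_one[of g] by (simp add: word_val_def)
  next
    case (Cons a w)
    let ?k = "letter_val abels_group (\<lambda>i. abels_gens ! i) a"
    have a: "snd a < 7" "set w \<subseteq> UNIV \<times> {..<7}" using Cons.prems by auto
    then have "letter_val Q y a \<in> carrier Q" using y by (simp add: letter_val_def)
    moreover have "abels_mult g (abels_eval (a # w)) = abels_mult (abels_mult g ?k) (abels_eval w)"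
      using Ab.m_assoc[of g ?k "abels_eval w"] by (simp add: word_val_def)
    ultimately show ?case
      using Cons.IH[OF a(2)] letter[OF a(1)] val_closed[OF a(2)] closed
      by (simp add: m_assoc) (simp add: word_val_def)
  qed
  from this[of "\<one>\<^bsub>abels_group\<^esub>"]
  have "assemble (abels_eval w) = assemble \<one>\<^bsub>abels_group\<^esub> \<otimes>\<^bsub>Q\<^esub> word_val Q y w"
    using Ab.l_one[of "abels_eval w"] by simp
  moreover have int: "assemble (Abels 0 0 0 0 0 (of_int n) 0 0) = \<one>\<^bsub>Q\<^esub>" for n
    using X14_of_int[of n] by simp
  have "assemble \<one>\<^bsub>abels_group\<^esub> = \<one>\<^bsub>Q\<^esub>" using int[of 0] by simp
  moreover obtain n where "abels_eval w = Abels 0 0 0 0 0 (of_int n) 0 0"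
    using w(2) by (auto simp: central_ints_def)
  ultimately show ?thesis using int[of n] val_closed[OF w(1)] by simp
qed

text \<open>
  Conjugation by the diagonal generators or their inverses halves the parameter in each of the five
  generating positions, and the corner is reached by the commutators of positions \<open>12\<close> and \<open>24\<close>.
\<close>

lemma subgroup_with_abels_gens:
  assumes S: "subgroup S abels_group" and gens: "set abels_gens \<subseteq> S"
  shows "S = UNIV"
proof -
  interpret S: subgroup S abels_group by fact
  have mult: "abels_mult g h \<in> S" if "g \<in> S" "h \<in> S" for g h
    using S.m_closed[OF that] by simp
  have inv: "abels_inv g \<in> S" if "g \<in> S" for g
    using S.m_inv_closed[OF that] by simp
  have S_diff: "abels_mult g (abels_inv h) \<in> S" if "g \<in> S" "h \<in> S" for g h
    using that by (intro mult inv)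
  have conj: "abels_mult (abels_mult g h) (abels_inv g) \<in> S" if "g \<in> S" "h \<in> S" for g h
    using that by (intro mult inv)
  have base: "Abels 1 0 0 0 0 0 0 0 \<in> S" "Abels 0 1 0 0 0 0 0 0 \<in> S" "Abels 0 0 1 0 0 0 0 0 \<in> S"
    "Abels 0 0 0 1 0 0 0 0 \<in> S" "Abels 0 0 0 0 1 0 0 0 \<in> S" and
    s: "Abels 0 0 0 0 0 0 1 0 \<in> S" and t: "Abels 0 0 0 0 0 0 0 1 \<in> S"
    using gens by (simp_all add: abels_gens_def)
  have s': "Abels 0 0 0 0 0 0 (- 1) 0 \<in> S" and t': "Abels 0 0 0 0 0 0 0 (- 1) \<in> S"
    using inv[OF s] inv[OF t] by simp_all
  have 12: "Abels a 0 0 0 0 0 0 0 \<in> S" for a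
  proof (induction a rule: dyadic_induct)
    case (diff a b) then show ?case using S_diff[of "Abels a 0 0 0 0 0 0 0" "Abels b 0 0 0 0 0 0 0"] by simp
  next
    case (half a) then show ?case using conj[OF s, of "Abels a 0 0 0 0 0 0 0"] by simp
  qed (fact base)
  have 23: "Abels 0 a 0 0 0 0 0 0 \<in> S" for a
  proof (induction a rule: dyadic_induct)
    case (diff a b) then show ?case using S_diff[of "Abels 0 a 0 0 0 0 0 0" "Abels 0 b 0 0 0 0 0 0"] by simp
  next
    case (half a) then show ?case using conj[OF t, of "Abels 0 a 0 0 0 0 0 0"] by simp
  qed (fact base)
  have 34: "Abels 0 0 a 0 0 0 0 0 \<in> S" for a
  proof (induction a rule: dyadic_induct)
    case (diff a b) then show ?case using S_diff[of "Abels 0 0 a 0 0 0 0 0" "Abels 0 0 b 0 0 0 0 0"] by simp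
  next
    case (half a) then show ?case using conj[OF t', of "Abels 0 0 a 0 0 0 0 0"] by simp
  qed (fact base)
  have 13: "Abels 0 0 0 a 0 0 0 0 \<in> S" for a
  proof (induction a rule: dyadic_induct)
    case (diff a b) then show ?case using S_diff[of "Abels 0 0 0 a 0 0 0 0" "Abels 0 0 0 b 0 0 0 0"] by simp
  next
    case (half a) then show ?case using conj[OF t, of "Abels 0 0 0 a 0 0 0 0"] by simp
  qed (fact base)
  have 24: "Abels 0 0 0 0 a 0 0 0 \<in> S" for a
  proof (induction a rule: dyadic_induct)
    case (diff a b) then show ?case using S_diff[of "Abels 0 0 0 0 a 0 0 0" "Abels 0 0 0 0 b 0 0 0"] by simp
  next
    case (half a) then show ?case using conj[OF s', of "Abels 0 0 0 0 a 0 0 0"] by simp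
  qed (fact base)
  have "abels_mult (Abels 1 0 0 0 0 0 0 0) (Abels 0 0 0 0 a 0 0 0) \<in> S"
      "abels_mult (Abels 0 0 0 0 a 0 0 0) (Abels 1 0 0 0 0 0 0 0) \<in> S" for a
    using 12 24 by (intro mult; simp)+
  then have 14: "Abels 0 0 0 0 0 a 0 0 \<in> S" for a
    using S_diff[of "abels_mult (Abels 1 0 0 0 0 0 0 0) (Abels 0 0 0 0 a 0 0 0)"
        "abels_mult (Abels 0 0 0 0 a 0 0 0) (Abels 1 0 0 0 0 0 0 0)"] by simp
  have i: "Abels 0 0 0 0 0 0 i 0 \<in> S" for i
  proof (induction i rule: int_induct[of _ 0])
    case base then show ?case using S.one_closed by simp
  next
    case (step1 i) then show ?case using mult[OF step1(2) s] by simp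
  next
    case (step2 i) then show ?case using mult[OF step2(2) s'] by simp
  qed
  have j: "Abels 0 0 0 0 0 0 0 j \<in> S" for j
  proof (induction j rule: int_induct[of _ 0])
    case base then show ?case using S.one_closed by simp
  next
    case (step1 i) then show ?case using mult[OF step1(2) t] by simp
  next
    case (step2 i) then show ?case using mult[OF step2(2) t'] by simp
  qed
  have "Abels a b c d e f i j \<in> S" for a b c d e f i j
    using mult[OF 14[of f] mult[OF 24[of e] mult[OF 34[of c] mult[OF 13[of d]
        mult[OF 23[of b] mult[OF 12[of a] mult[OF i[of i] j[of j]]]]]]]]
    by simp
  then show ?thesis by (metis UNIV_eq_I abels.exhaust)
qed

lemma abels_gens_closed: "abels_gens ! i \<in> carrier abels_group"
  by simp

lemma abels_eval_epi: "abels_eval \<in> epi (free_group 7) abels_group"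
proof -
  note univ = free_group_universal[where m = 7 and g = "\<lambda>i. abels_gens ! i",
      OF group_abels_group abels_gens_closed]
  interpret ev: group_hom "free_group 7" abels_group abels_eval
    using univ(1) by (intro group_hom.intro group_hom_axioms.intro group_free_group group_abels_group)
  have "set abels_gens \<subseteq> abels_eval ` carrier (free_group 7)"
  proof -
    have "abels_gens ! i \<in> abels_eval ` carrier (free_group 7)" if "i < 7" for i
    proof (rule image_eqI)
      show "abels_gens ! i = abels_eval [(False, i)]" by (rule univ(2)[OF that, symmetric])
      show "[(False, i)] \<in> carrier (free_group 7)" using that by (simp add: free_group_def)
    qed
    moreover have "length abels_gens = 7" by (simp add: abels_gens_def)
    ultimately show ?thesis by (metis in_set_conv_nth subsetI)
  qed
  then have "abels_eval ` carrier (free_group 7) = UNIV"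
    by (intro subgroup_with_abels_gens ev.img_is_subgroup)
  with univ(1) show ?thesis by (simp add: epi_def)
qed

text \<open>
  Membership of a fixed word is one coordinate of the product space, so it is a clopen condition.
\<close>

lemma openin_marked_groups:
  assumes "w \<in> carrier (free_group m)"
  shows "openin (marked_groups m) {M. M \<lhd> free_group m \<and> w \<in> M}"
    and "openin (marked_groups m) {M. M \<lhd> free_group m \<and> w \<notin> M}"
proof -
  let ?F = "carrier (free_group m)"
  let ?T = "product_topology (\<lambda>_. discrete_topology (UNIV :: bool set)) ?F"
  have "openin ?T {f \<in> topspace ?T. f w \<in> {b}}" for b
    by (rule openin_continuous_map_preimage[OF continuous_map_product_projection[OF assms]]) simp
  then have "openin (marked_groups m)
      ((\<lambda>N. \<lambda>w\<in>?F. w \<in> N) -` {f \<in> topspace ?T. f w \<in> {b}} \<inter> {N. N \<lhd> free_group m})" for b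
    unfolding marked_groups_def openin_pullback_topology by blast
  from this[of True] this[of False]
  show "openin (marked_groups m) {M. M \<lhd> free_group m \<and> w \<in> M}"
    "openin (marked_groups m) {M. M \<lhd> free_group m \<and> w \<notin> M}"
    using assms by (simp_all add: vimage_def Int_def conj_commute)
qed

lemma word_val_hom:
  assumes "group Q" "\<phi> \<in> hom (free_group m) Q" "w \<in> carrier (free_group m)"
  shows "word_val Q (\<lambda>i. \<phi> [(False, i)]) w = \<phi> w"
proof -
  let ?F = "free_group m" and ?v = "word_val Q (\<lambda>i. \<phi> [(False, i)])"
  have gen: "[(False, i)] \<in> carrier ?F" if "i < m" for i using that by (auto simp: free_group_def)
  then have closed: "\<phi> [(False, i)] \<in> carrier Q" if "i < m" for i
    using assms(2) that by (auto simp: hom_def)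
  note univ = free_group_universal[OF \<open>group Q\<close> closed]
  interpret \<phi>: group_hom ?F Q \<phi>
    using assms by (intro group_hom.intro group_hom_axioms.intro group_free_group)
  interpret v: group_hom ?F Q ?v
    using assms(1) univ(1) by (intro group_hom.intro group_hom_axioms.intro group_free_group)
  let ?S = "(\<lambda>i. [(False, i)]) ` {..<m}"
  have "w \<in> generate ?F ?S" using assms(3) by (simp add: generate_free_group)
  then show ?thesis
  proof (induction w rule: generate.induct)
    case (eng h1 h2)
    then have "h1 \<in> carrier ?F" "h2 \<in> carrier ?F" by (simp_all add: generate_free_group)
    with eng show ?case by simp
  qed (use gen univ(2) in auto)
qed

text \<open>
  The neighbourhood that separates \<open>N\<close> from all other normal subgroups contains the relators and omits
  one word \<open>w0\<close> for the corner entry \<open>1/2\<close>. The relators force \<open>N \<subseteq> M\<close>, and the image in Abels' group of a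
  larger \<open>M\<close> would contain the value of \<open>w0\<close>.
\<close>

theorem isolated_abels_quotient:
  defines "N \<equiv> {w \<in> carrier (free_group 7). abels_eval w \<in> central_ints}"
  assumes N: "N \<lhd> free_group 7"
  shows "openin (marked_groups 7) {N}"
proof -
  let ?F = "free_group 7" and ?half = "Abels 0 0 0 0 0 (pow2 (- 1)) 0 0"
  interpret F: group ?F by (rule group_free_group)
  have surj: "abels_eval ` carrier ?F = UNIV" using abels_eval_epi by (simp add: epi_def)
  interpret ev: group_hom ?F abels_group abels_eval
    using abels_eval_epi
    by (intro group_hom.intro group_hom_axioms.intro group_free_group group_abels_group) (simp add: epi_def)
  obtain w0 where w0: "w0 \<in> carrier ?F" "abels_eval w0 = ?half"
    using surj by (metis UNIV_I imageE)
  define R where "R = (\<lambda>(u, v). positive_word u \<otimes>\<^bsub>?F\<^esub> inv\<^bsub>?F\<^esub> positive_word v) ` set abels_relators"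
  have pos: "positive_word u \<in> carrier ?F" "positive_word v \<in> carrier ?F"
    if "(u, v) \<in> set abels_relators" for u v
    using that by (intro positive_word_carrier; auto simp: abels_relators_def)+
  have R: "R \<subseteq> carrier ?F" "finite R" using pos by (auto simp: R_def)
  define U where "U = topspace (marked_groups 7) \<inter> (\<Inter>r\<in>R. {M. M \<lhd> ?F \<and> r \<in> M}) \<inter> {M. M \<lhd> ?F \<and> w0 \<notin> M}"
  have "openin (marked_groups 7) U"
    unfolding U_def using R w0(1)
    by (intro openin_Int openin_marked_groups openin_Int_Inter) (auto intro: openin_marked_groups)
  moreover have "N \<in> U"
  proof -
    have "abels_eval (positive_word u \<otimes>\<^bsub>?F\<^esub> inv\<^bsub>?F\<^esub> positive_word v) \<in> central_ints"
      if "(u, v) \<in> set abels_relators" for u v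
    proof -
      let ?u = "abels_eval (positive_word u)" and ?v = "abels_eval (positive_word v)"
      have "abels_mult ?u (abels_inv ?v) \<in> {Abels 0 0 0 0 0 0 0 0, Abels 0 0 0 0 0 1 0 0}"
        using abels_relations_hold[OF that] Ab.r_inv[of ?v] Ab.r_one
          Ab.m_assoc[of "Abels 0 0 0 0 0 1 0 0" ?v "abels_inv ?v"] by auto
      also have "\<dots> \<subseteq> central_ints"
        unfolding central_ints_def
        by (auto intro: image_eqI[of _ _ 0] image_eqI[of _ _ 1])
      finally show ?thesis using pos[OF that] by simp
    qed
    then have "R \<subseteq> N" using pos by (auto simp: R_def N_def)
    moreover have "w0 \<notin> N" using w0(2) half_not_int by (auto simp: N_def central_ints_def)
    ultimately show ?thesis using assms(2) by (auto simp: U_def topspace_marked_groups)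
  qed
  moreover have "M = N" if "M \<in> U" for M
  proof (rule ccontr)
    assume "M \<noteq> N"
    have M: "M \<lhd> ?F" "R \<subseteq> M" "w0 \<notin> M" using that by (auto simp: U_def)
    interpret M: normal M ?F by fact
    let ?\<pi> = "\<lambda>w. M #>\<^bsub>?F\<^esub> w"
    have hom: "?\<pi> \<in> hom ?F (?F Mod M)" by (rule M.r_coset_hom_Mod)
    have "N \<subseteq> M"
    proof
      fix w assume w: "w \<in> N"
      then have wF: "w \<in> carrier ?F" by (simp add: N_def)
      have "word_val (?F Mod M) (\<lambda>i. ?\<pi> [(False, i)]) w = \<one>\<^bsub>?F Mod M\<^esub>"
      proof (rule abels_relators_present)
        show "group (?F Mod M)" by (rule M.factorgroup_is_group)
        show "?\<pi> [(False, i)] \<in> carrier (?F Mod M)" if "i < 7" for i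
          using that hom by (auto simp: hom_def free_group_def)
        show "set w \<subseteq> UNIV \<times> {..<7}" "abels_eval w \<in> central_ints"
          using w by (auto simp: N_def free_group_def)
        fix u v assume uv: "(u, v) \<in> set abels_relators"
        then have "positive_word u \<otimes>\<^bsub>?F\<^esub> inv\<^bsub>?F\<^esub> positive_word v \<in> M"
          using M(2) by (auto simp: R_def)
        then have "?\<pi> (positive_word u) = ?\<pi> (positive_word v)"
          using pos[OF uv] by (metis F.repr_independence M.rcos_module M.subgroup_axioms F.is_group)
        then show "word_val (?F Mod M) (\<lambda>i. ?\<pi> [(False, i)]) (positive_word u) =
            word_val (?F Mod M) (\<lambda>i. ?\<pi> [(False, i)]) (positive_word v)"
          using pos[OF uv] by (simp add: word_val_hom[OF M.factorgroup_is_group hom])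
      qed
      then have "?\<pi> w = M" by (simp add: word_val_hom[OF M.factorgroup_is_group hom wF])
      then show "w \<in> M" using wF by (metis F.coset_join1 M.subgroup_axioms)
    qed
    have "abels_eval ` M \<lhd> abels_group"
    proof (rule Ab.normal_invI)
      show "subgroup (abels_eval ` M) abels_group"
        by (rule ev.subgroup_img_is_subgroup[OF M.subgroup_axioms])
      fix g h assume "h \<in> abels_eval ` M"
      then obtain v where v: "v \<in> M" "h = abels_eval v" by blast
      obtain u where u: "u \<in> carrier ?F" "g = abels_eval u" using surj by (metis UNIV_I imageE)
      have "g \<otimes>\<^bsub>abels_group\<^esub> h \<otimes>\<^bsub>abels_group\<^esub> inv\<^bsub>abels_group\<^esub> g =
          abels_eval (u \<otimes>\<^bsub>?F\<^esub> v \<otimes>\<^bsub>?F\<^esub> inv\<^bsub>?F\<^esub> u)"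
        using u v by (simp del: inv_abels_group abels_group_simps)
      then show "g \<otimes>\<^bsub>abels_group\<^esub> h \<otimes>\<^bsub>abels_group\<^esub> inv\<^bsub>abels_group\<^esub> g \<in> abels_eval ` M"
        using M.inv_op_closed2[OF u(1) v(1)] by blast
    qed
    moreover have "central_ints \<subseteq> abels_eval ` M"
    proof
      fix g assume g: "g \<in> central_ints"
      obtain u where "u \<in> carrier ?F" "g = abels_eval u" using surj by (metis UNIV_I imageE)
      with g \<open>N \<subseteq> M\<close> show "g \<in> abels_eval ` M" by (auto simp: N_def)
    qed
    moreover have "abels_eval ` M \<noteq> central_ints"
    proof
      assume "abels_eval ` M = central_ints"
      then have "M \<subseteq> N" by (auto simp: N_def)
      with \<open>N \<subseteq> M\<close> \<open>M \<noteq> N\<close> show False by blast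
    qed
    ultimately have "?half \<in> abels_eval ` M" by (rule half_mem_normal_subgroup)
    then obtain v where v: "v \<in> M" "abels_eval v = ?half" by auto
    then have "abels_eval (w0 \<otimes>\<^bsub>?F\<^esub> inv\<^bsub>?F\<^esub> v) = \<one>\<^bsub>abels_group\<^esub>"
      using w0 Ab.r_inv[of ?half] by (simp del: Ab.r_inv)
    then have "w0 \<otimes>\<^bsub>?F\<^esub> inv\<^bsub>?F\<^esub> v \<in> N"
      using w0(1) v(1) by (auto simp: N_def central_ints_def intro: image_eqI[of _ _ 0])
    then have "w0 \<otimes>\<^bsub>?F\<^esub> inv\<^bsub>?F\<^esub> v \<otimes>\<^bsub>?F\<^esub> v \<in> M"
      using \<open>N \<subseteq> M\<close> v(1) by blast
    then show False using M(3) w0(1) v(1) by (simp add: F.m_assoc)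
  qed
  ultimately have "U = {N}" by blast
  with \<open>openin (marked_groups 7) U\<close> show ?thesis by simp
qed

theorem proposition10:
  shows "\<exists>G :: nat monoid. isolated_group G \<and> k_solvable 3 G \<and> non_hopfian G"
proof -
  let ?F = "free_group 7"
  obtain q :: "abels \<Rightarrow> nat" where q: "weak_group_morphism q central_ints abels_group"
    using countable_quotient_encoding[OF normal_central_ints] by blast
  define G where "G = image_group q abels_group"
  have grp: "group G" unfolding G_def by (rule Ab.image_group_is_group[OF q])
  have q_hom: "q \<in> hom abels_group G" unfolding G_def by (rule Ab.weak_group_morphism_is_hom[OF q])
  have q_ker: "kernel abels_group G q = central_ints"
    unfolding G_def by (rule Ab.weak_group_morphism_ker[OF q])
  have q_surj: "q ` UNIV = carrier G" by (simp add: G_def image_group_carrier)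
  interpret q: group_hom abels_group G q
    by (intro group_hom.intro group_hom_axioms.intro group_abels_group grp q_hom)
  define h where "h = q \<circ> abels_eval"
  have h_epi: "h \<in> epi ?F G"
    unfolding h_def using abels_eval_epi q_hom q_surj by (intro epi_compose) (auto simp: epi_def)
  interpret h: group_hom ?F G h
    using h_epi by (intro group_hom.intro group_hom_axioms.intro group_free_group grp) (simp add: epi_def)
  have h_surj: "h ` carrier ?F = carrier G" using h_epi by (simp add: epi_def)
  have h_ker: "kernel ?F G h = {w \<in> carrier ?F. abels_eval w \<in> central_ints}"
    using q_ker by (auto simp: kernel_def h_def)
  have "isolated_group G"
    unfolding isolated_group_def
  proof (intro conjI exI)
    show "kernel ?F G h \<lhd> ?F" by (rule h.normal_kernel)
    show "?F Mod kernel ?F G h \<cong> G" using h.FactGroup_iso[OF h_surj] .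
    show "openin (marked_groups 7) {kernel ?F G h}"
      using isolated_abels_quotient h.normal_kernel unfolding h_ker by blast
    let ?S = "(\<lambda>i. [(False, i)]) ` {..<7}"
    have S: "?S \<subseteq> carrier ?F" by (auto simp: free_group_def)
    have "generate G (h ` ?S) = carrier G"
      using h.generate_img[OF S] h_surj by (simp add: generate_free_group)
    then show "finitely_generated_group G"
      unfolding finitely_generated_group_def using grp S h_surj by (intro conjI exI[of _ "h ` ?S"]) auto
  qed
  moreover have "k_solvable 3 G"
    unfolding k_solvable_def using grp q.exp_of_derived_img[of UNIV 3] q.hom_one
    by (simp add: derived_length_abels_group q_surj)
  moreover have "non_hopfian G"
  proof (rule q.non_hopfian_image)
    show "q ` carrier abels_group = carrier G" using q_surj by simp
    show "doubling \<in> epi abels_group abels_group"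
      using doubling_hom surj_doubling by (simp add: epi_def)
    show "doubling g \<in> kernel abels_group G q" if "g \<in> kernel abels_group G q" for g
      using that unfolding q_ker by (auto simp: central_ints_def intro: image_eqI[of _ _ "2 * _"])
    let ?half = "Abels 0 0 0 0 0 (pow2 (- 1)) 0 0"
    show "?half \<in> carrier abels_group" by simp
    show "?half \<notin> kernel abels_group G q"
      unfolding q_ker using half_not_int by (auto simp: central_ints_def)
    show "doubling ?half \<in> kernel abels_group G q"
      unfolding q_ker using pow2_minus_cancel(2)[of 1]
      by (auto simp: central_ints_def pow2_1 intro: image_eqI[of _ _ 1])
  qed
  ultimately show ?thesis by blast
qed

end
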